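(* Let $1\leq p<\infty$, let $X,Y$ be Banach spaces and let $T:X\rightarrow Y$ be an operator. The following are equivalent: (1) $T$ is unconditionally $p$-converging; (2) $TS$ is compact for every operator $S\in\mathcal{L}(l_{p^{*}},X)$ (for every $S\in\mathcal{L}(c_{0},X)$ when $p=1$).
   Context: Banach spaces are real or complex; an operator is a continuous linear map; $\mathcal{L}(X,Y)$ is the space of operators from $X$ to $Y$; $B_{X^{*}}$ is the closed unit ball of $X^{*}$; $p^{*}$ is the conjugate exponent of $p$. For $1\leq p<\infty$, a sequence $(x_n)_n$ in $X$ is weakly $p$-summable, written $(x_n)_n\in l_p^w(X)$, if $\|(x_n)_n\|_p^w:=\sup\{(\sum_{n=1}^{\infty}|\langle x^*,x_n\rangle|^p)^{1/p}:x^*\in B_{X^*}\}<\infty$. A sequence $(x_n)_n\in l_p^w(X)$ is unconditionally $p$-summable, written $(x_n)_n\in l_p^u(X)$, if $\sup\{(\sum_{n=m}^{\infty}|\langle x^*,x_n\rangle|^p)^{1/p}:x^*\in B_{X^*}\}\to 0$ as $m\to\infty$. An operator $T:X\to Y$ is unconditionally $p$-converging if $(Tx_n)_n\in l_p^u(Y)$ for every $(x_n)_n\in l_p^w(X)$. *)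

theory Defs
  imports "HOL-Analysis.Analysis"
begin

text \<open>
  The scalar field of a Banach space is real or complex. This class makes both cases available at
  once: up to an isometric isomorphism of fields, its members are exactly the real and the complex
  numbers.
\<close>

class real_or_complex = real_normed_field +
  assumes real_or_complex:
    "\<exists>h :: 'a \<Rightarrow> complex.
       (\<forall>x y. h (x + y) = h x + h y) \<and> (\<forall>x y. h (x * y) = h x * h y) \<and>
       (\<forall>r x. h (r *\<^sub>R x) = r *\<^sub>R h x) \<and> (\<forall>x. norm (h x) = norm x) \<and>
       (range h = \<real> \<or> range h = UNIV)"

instance real :: real_or_complex
proof
  show "\<exists>h :: real \<Rightarrow> complex.
       (\<forall>x y. h (x + y) = h x + h y) \<and> (\<forall>x y. h (x * y) = h x * h y) \<and>
       (\<forall>r x. h (r *\<^sub>R x) = r *\<^sub>R h x) \<and> (\<forall>x. norm (h x) = norm x) \<and>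
       (range h = \<real> \<or> range h = UNIV)"
    by (rule exI[of _ complex_of_real]) (auto simp: Reals_def scaleR_conv_of_real)
qed

instance complex :: real_or_complex
proof
  show "\<exists>h :: complex \<Rightarrow> complex.
       (\<forall>x y. h (x + y) = h x + h y) \<and> (\<forall>x y. h (x * y) = h x * h y) \<and>
       (\<forall>r x. h (r *\<^sub>R x) = r *\<^sub>R h x) \<and> (\<forall>x. norm (h x) = norm x) \<and>
       (range h = \<real> \<or> range h = UNIV)"
    by (rule exI[of _ id]) auto
qed

text \<open>
  A Banach space over \<open>'k\<close>. Class \<open>banach\<close> provides the complete norm and the underlying real
  vector space. The scalar multiplication is an explicit parameter because the library has no class
  of complex normed spaces. For \<open>'k = real\<close> it can only be \<open>(*\<^sub>R)\<close>.
\<close>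

locale banach_space = vector_space scale
  for scale :: "'k::real_or_complex \<Rightarrow> 'a::banach \<Rightarrow> 'a" +
  assumes norm_scale: "norm (scale c x) = norm c * norm x"
    and scale_of_real: "scale (of_real r) x = r *\<^sub>R x"

lemma banach_space_scaleR: "banach_space ((*\<^sub>R) :: real \<Rightarrow> 'a::banach \<Rightarrow> 'a)"
  by unfold_locales (auto simp: algebra_simps)

definition is_operator ::
    "('k::real_or_complex \<Rightarrow> 'a::banach \<Rightarrow> 'a) \<Rightarrow> ('k \<Rightarrow> 'b::real_normed_vector \<Rightarrow> 'b) \<Rightarrow> ('a \<Rightarrow> 'b) \<Rightarrow> bool"
  where "is_operator sX sY T \<longleftrightarrow> bounded_linear T \<and> (\<forall>c x. T (sX c x) = sY c (T x))"

definition dual_ball :: "('k::real_or_complex \<Rightarrow> 'a::banach \<Rightarrow> 'a) \<Rightarrow> ('a \<Rightarrow> 'k) set"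
  where "dual_ball sX = {f. is_operator sX (*) f \<and> onorm f \<le> 1}"

definition lp_norm :: "real \<Rightarrow> (nat \<Rightarrow> 'k::real_normed_vector) \<Rightarrow> ennreal"
  where "lp_norm p a =
    (if summable (\<lambda>n. norm (a n) powr p) then ennreal ((\<Sum>n. norm (a n) powr p) powr (1 / p)) else \<infinity>)"

definition weak_lp_norm ::
    "real \<Rightarrow> ('k::real_or_complex \<Rightarrow> 'a::banach \<Rightarrow> 'a) \<Rightarrow> (nat \<Rightarrow> 'a) \<Rightarrow> ennreal"
  where "weak_lp_norm p sX x = (SUP f \<in> dual_ball sX. lp_norm p (\<lambda>n. f (x n)))"

definition weakly_p_summable ::
    "real \<Rightarrow> ('k::real_or_complex \<Rightarrow> 'a::banach \<Rightarrow> 'a) \<Rightarrow> (nat \<Rightarrow> 'a) set"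
  where "weakly_p_summable p sX = {x. weak_lp_norm p sX x < \<infinity>}"

definition uncond_p_summable ::
    "real \<Rightarrow> ('k::real_or_complex \<Rightarrow> 'a::banach \<Rightarrow> 'a) \<Rightarrow> (nat \<Rightarrow> 'a) set"
  where "uncond_p_summable p sX =
    {x \<in> weakly_p_summable p sX. (\<lambda>m. weak_lp_norm p sX (\<lambda>n. x (n + m))) \<longlonglongrightarrow> 0}"

definition uncond_p_converging ::
    "real \<Rightarrow> ('k::real_or_complex \<Rightarrow> 'a::banach \<Rightarrow> 'a) \<Rightarrow> ('k \<Rightarrow> 'b::banach \<Rightarrow> 'b) \<Rightarrow> ('a \<Rightarrow> 'b) \<Rightarrow> bool"
  where "uncond_p_converging p sX sY T \<longleftrightarrow>
    (\<forall>x \<in> weakly_p_summable p sX. (\<lambda>n. T (x n)) \<in> uncond_p_summable p sY)"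

text \<open>
  The exponent is not known at the type level, so a sequence space over \<open>'k\<close> is a carrier set of
  sequences together with a norm on that carrier.
\<close>

definition lp_space :: "real \<Rightarrow> (nat \<Rightarrow> 'k::real_or_complex) set"
  where "lp_space q = {a. lp_norm q a < \<infinity>}"

definition lp_space_norm :: "real \<Rightarrow> (nat \<Rightarrow> 'k::real_or_complex) \<Rightarrow> real"
  where "lp_space_norm q a = enn2real (lp_norm q a)"

definition c0_space :: "(nat \<Rightarrow> 'k::real_or_complex) set"
  where "c0_space = {a. a \<longlonglongrightarrow> 0}"

definition c0_space_norm :: "(nat \<Rightarrow> 'k::real_or_complex) \<Rightarrow> real"
  where "c0_space_norm a = (SUP n. norm (a n))"

text \<open>
  An operator from the sequence space with carrier \<open>L\<close> and norm \<open>N\<close>, i.e. a bounded linear map.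
  Values of \<open>S\<close> outside \<open>L\<close> are irrelevant.
\<close>

definition is_seq_operator ::
    "(nat \<Rightarrow> 'k::real_or_complex) set \<Rightarrow> ((nat \<Rightarrow> 'k) \<Rightarrow> real) \<Rightarrow> ('k \<Rightarrow> 'a::banach \<Rightarrow> 'a) \<Rightarrow>
     ((nat \<Rightarrow> 'k) \<Rightarrow> 'a) \<Rightarrow> bool"
  where "is_seq_operator L N sX S \<longleftrightarrow>
    (\<forall>a\<in>L. \<forall>b\<in>L. S (\<lambda>n. a n + b n) = S a + S b) \<and>
    (\<forall>c. \<forall>a\<in>L. S (\<lambda>n. c * a n) = sX c (S a)) \<and>
    (\<exists>K. \<forall>a\<in>L. norm (S a) \<le> K * N a)"

definition is_compact_seq_operator ::
    "(nat \<Rightarrow> 'k::real_or_complex) set \<Rightarrow> ((nat \<Rightarrow> 'k) \<Rightarrow> real) \<Rightarrow> ('k \<Rightarrow> 'a::banach \<Rightarrow> 'a) \<Rightarrow>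
     ((nat \<Rightarrow> 'k) \<Rightarrow> 'a) \<Rightarrow> bool"
  where "is_compact_seq_operator L N sX S \<longleftrightarrow>
    is_seq_operator L N sX S \<and> compact (closure (S ` {a \<in> L. N a \<le> 1}))"

text \<open>Only meaningful for \<open>1 < p\<close>. For \<open>p = 1\<close> the space \<open>c\<^sub>0\<close> takes the place of the sequence space
  with the conjugate exponent.\<close>

definition conj_exponent :: "real \<Rightarrow> real"
  where "conj_exponent p = p / (p - 1)"

end

theory Submission
  imports Defs
begin

text \<open>
  Let \<open>L\<close> be the sequence space \<open>l\<close> with the exponent conjugate to \<open>p\<close>, or \<open>c\<^sub>0\<close> if \<open>p = 1\<close>. Operators
  \<open>S\<close> from \<open>L\<close> to \<open>X\<close> and weakly \<open>p\<close>-summable sequences \<open>x\<close> in \<open>X\<close> are the same thing: \<open>x n\<close> is the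
  image of the \<open>n\<close>-th unit vector, and \<open>S a = \<Sum>n. a n x n\<close>. Under this correspondence, the weak norm
  of the tail of \<open>x\<close> from \<open>m\<close> on is the norm of \<open>S\<close> on the sequences that vanish before \<open>m\<close>
  (\<open>norm_combination_le\<close> and \<open>weak_lp_norm_le\<close>). So \<open>T x\<close> is unconditionally \<open>p\<close>-summable exactly
  when \<open>T S\<close> is the limit in norm of its restrictions to the first \<open>m\<close> coordinates, and it has to be
  seen that this is the same as compactness of \<open>T S\<close>.

  A limit in norm of operators of finite rank is compact. Conversely, if \<open>T S\<close> is not the limit of
  its truncations, then there are disjointly supported blocks in the unit ball of \<open>L\<close> on which the
  norm of \<open>T S\<close> is bounded away from \<open>0\<close>. If \<open>T S\<close> were compact, the images of a subsequence of the
  blocks would converge to a nonzero vector, and the image of a sum of \<open>k\<close> blocks would have norm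
  proportional to \<open>k\<close>. But a sum of \<open>k\<close> disjoint blocks has norm at most \<open>k powr (1 / q)\<close> for the
  conjugate exponent \<open>q\<close>, and at most \<open>1\<close> in \<open>c\<^sub>0\<close>.

  The locale \<open>sequence_duality\<close> collects the properties of \<open>L\<close> that this argument uses, so that both
  cases are treated at once. The passage from functionals to norms rests on the Hahn-Banach theorem,
  which is proved for real and complex scalars.
\<close>

section \<open>Norming functionals\<close>

definition sublinear :: "('a::real_vector \<Rightarrow> real) \<Rightarrow> bool"
  where "sublinear s \<longleftrightarrow>
    (\<forall>x y. s (x + y) \<le> s x + s y) \<and> (\<forall>t\<ge>0. \<forall>x. s (t *\<^sub>R x) \<le> t * s x)"

lemma sublinear_add: "sublinear s \<Longrightarrow> s (x + y) \<le> s x + s y"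
  and sublinear_scaleR: "sublinear s \<Longrightarrow> 0 \<le> t \<Longrightarrow> s (t *\<^sub>R x) \<le> t * s x"
  by (simp_all add: sublinear_def)

lemma sublinear_minus_le:
  assumes "sublinear s" shows "- s (- x) \<le> s x"
proof -
  have "s 0 \<le> s x + s (- x)"
    using sublinear_add[OF assms, of x "- x"] by simp
  moreover have "s 0 \<le> 2 * s 0 \<and> s 0 \<le> 0"
    using sublinear_add[OF assms, of 0 0] sublinear_scaleR[OF assms, of 0 0] by simp
  ultimately show ?thesis by linarith
qed

text \<open>
  The witness is \<open>r x = inf {s (x + t y) - t s y | t \<ge> 0}\<close>, that is, \<open>s\<close> lowered along the ray
  through \<open>y\<close>. The lemma serves twice. A sublinear functional that is minimal must be its own
  lowering in every direction, and the last inequality then makes it additive. Lowering the norm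
  along \<open>x\<close> puts \<open>r (- x) \<le> - norm x\<close>, which forces every linear functional below \<open>r\<close> to attain
  its norm at \<open>x\<close>.
\<close>

lemma sublinear_lowering:
  fixes s :: "'a::real_vector \<Rightarrow> real"
  assumes s: "sublinear s"
  obtains r where "sublinear r" "\<And>x. r x \<le> s x" "\<And>x. r x \<le> s (x + y) - s y"
proof
  define D where "D x = (\<lambda>t. s (x + t *\<^sub>R y) - t * s y) ` {0..}" for x
  define r where "r x = Inf (D x)" for x
  have below: "- s (- x) \<le> d" if "d \<in> D x" for x d
  proof -
    from that obtain t where t: "0 \<le> t" and d: "d = s (x + t *\<^sub>R y) - t * s y"
      by (auto simp: D_def)
    have "s (t *\<^sub>R y) \<le> s (x + t *\<^sub>R y) + s (- x)"
      using sublinear_add[OF s, of "x + t *\<^sub>R y" "- x"] by simp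
    moreover have "t * s y \<le> s (t *\<^sub>R y)"
    proof (cases "t = 0")
      case True
      then show ?thesis using sublinear_minus_le[OF s, of 0] by simp
    next
      case False
      then show ?thesis
        using sublinear_scaleR[OF s, of "1 / t" "t *\<^sub>R y"] t by (simp add: field_simps)
    qed
    ultimately show ?thesis using d by linarith
  qed
  have bdd: "bdd_below (D x)" for x
    by (rule bdd_belowI) (rule below)
  have ne: "D x \<noteq> {}" for x
    by (auto simp: D_def)
  have le: "r x \<le> s (x + t *\<^sub>R y) - t * s y" if "0 \<le> t" for x t
    unfolding r_def by (rule cInf_lower[OF _ bdd]) (use that in \<open>auto simp: D_def\<close>)
  show "r x \<le> s x" for x
    using le[of 0 x] by simp
  show "r x \<le> s (x + y) - s y" for x
    using le[of 1 x] by simp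
  have ge: "c \<le> r x" if "\<And>t. 0 \<le> t \<Longrightarrow> c \<le> s (x + t *\<^sub>R y) - t * s y" for c x
    unfolding r_def by (rule cInf_greatest[OF ne]) (use that in \<open>auto simp: D_def\<close>)
  show "sublinear r"
    unfolding sublinear_def
  proof (intro conjI allI impI)
    fix x z
    have *: "r (x + z) \<le> (s (x + t *\<^sub>R y) - t * s y) + (s (z + u *\<^sub>R y) - u * s y)"
      if "0 \<le> t" "0 \<le> u" for t u
    proof -
      have "r (x + z) \<le> s ((x + z) + (t + u) *\<^sub>R y) - (t + u) * s y"
        using that by (intro le) simp
      moreover have "s ((x + z) + (t + u) *\<^sub>R y) \<le> s (x + t *\<^sub>R y) + s (z + u *\<^sub>R y)"
        using sublinear_add[OF s, of "x + t *\<^sub>R y" "z + u *\<^sub>R y"] by (simp add: algebra_simps)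
      ultimately show ?thesis by (simp add: algebra_simps)
    qed
    have "r (x + z) - (s (x + t *\<^sub>R y) - t * s y) \<le> r z" if "0 \<le> t" for t
    proof (rule ge)
      fix u :: real assume "0 \<le> u"
      then show "r (x + z) - (s (x + t *\<^sub>R y) - t * s y) \<le> s (z + u *\<^sub>R y) - u * s y"
        using *[OF that, of u] by simp
    qed
    then have "r (x + z) - r z \<le> r x"
      by (intro ge) (simp add: algebra_simps)
    then show "r (x + z) \<le> r x + r z" by simp
  next
    fix t :: real and x assume t: "0 \<le> t"
    show "r (t *\<^sub>R x) \<le> t * r x"
    proof (cases "t = 0")
      case True
      have "r 0 \<le> s 0" using le[of 0 0] by simp
      also have "\<dots> \<le> 0" using sublinear_scaleR[OF s, of 0 0] by simp
      finally show ?thesis using True by simp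
    next
      case False
      have "r (t *\<^sub>R x) / t \<le> r x"
      proof (rule ge)
        fix u :: real assume u: "0 \<le> u"
        have "r (t *\<^sub>R x) \<le> s (t *\<^sub>R x + (t * u) *\<^sub>R y) - (t * u) * s y"
          using t u by (intro le) simp
        also have "s (t *\<^sub>R x + (t * u) *\<^sub>R y) \<le> t * s (x + u *\<^sub>R y)"
          using sublinear_scaleR[OF s t, of "x + u *\<^sub>R y"] by (simp add: algebra_simps)
        finally show "r (t *\<^sub>R x) / t \<le> s (x + u *\<^sub>R y) - u * s y"
          using t False by (simp add: field_simps)
      qed
      then show ?thesis using t False by (simp add: field_simps)
    qed
  qed
qed

lemma sublinear_chain_lower_bound:
  fixes C :: "('a::real_vector \<Rightarrow> real) set"
  assumes ne: "C \<noteq> {}" and sub: "\<And>s. s \<in> C \<Longrightarrow> sublinear s"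
    and chain: "\<And>s r. s \<in> C \<Longrightarrow> r \<in> C \<Longrightarrow> s \<le> r \<or> r \<le> s"
    and m: "\<And>s x. s \<in> C \<Longrightarrow> m x \<le> s x"
  shows "\<exists>u. sublinear u \<and> (\<forall>s\<in>C. u \<le> s)"
proof -
  define u where "u x = (INF s\<in>C. s x)" for x
  have le: "u x \<le> s x" if "s \<in> C" for s x
    unfolding u_def using m that by (intro cINF_lower) (auto intro!: bdd_belowI)
  have ge: "c \<le> u x" if "\<And>s. s \<in> C \<Longrightarrow> c \<le> s x" for c x
    unfolding u_def using ne that by (intro cINF_greatest)
  have "sublinear u"
    unfolding sublinear_def
  proof (intro conjI allI impI)
    fix x y
    \<comment> \<open>Two members of the chain are both above the smaller of them, which is subadditive.\<close>
    have *: "u (x + y) \<le> s x + r y" if sr: "s \<in> C" "r \<in> C" for s r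
    proof -
      obtain v where v: "v \<in> C" "v \<le> s" "v \<le> r"
        using chain[OF sr] sr by blast
      have "u (x + y) \<le> v x + v y"
        using le[OF v(1), of "x + y"] sublinear_add[OF sub[OF v(1)], of x y] by linarith
      also have "\<dots> \<le> s x + r y"
        using v(2,3) by (intro add_mono) (auto simp: le_fun_def)
      finally show ?thesis .
    qed
    have "u (x + y) - s x \<le> u y" if "s \<in> C" for s
      by (rule ge) (use *[OF that] in \<open>simp add: algebra_simps\<close>)
    then have "u (x + y) - u y \<le> u x"
      by (intro ge) (simp add: algebra_simps)
    then show "u (x + y) \<le> u x + u y" by simp
  next
    fix t :: real and x assume t: "0 \<le> t"
    have *: "u (t *\<^sub>R x) \<le> t * s x" if "s \<in> C" for s
      using le[OF that, of "t *\<^sub>R x"] sublinear_scaleR[OF sub[OF that] t, of x] by linarith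
    show "u (t *\<^sub>R x) \<le> t * u x"
    proof (cases "t = 0")
      case True
      then show ?thesis using * ne by auto
    next
      case False
      then have "u (t *\<^sub>R x) / t \<le> u x"
        using * t by (intro ge) (simp add: field_simps)
      then show ?thesis using False t by (simp add: field_simps)
    qed
  qed
  then show ?thesis using le by (auto simp: le_fun_def)
qed

text \<open>
  Zorn's lemma gives a minimal sublinear functional below \<open>s\<close>, and minimality makes it linear. In
  this form of the Hahn-Banach theorem, the functionals that are compared are sublinear and defined
  on the whole space, instead of linear and defined on subspaces.
\<close>

lemma linear_below_sublinear:
  fixes s :: "'a::real_vector \<Rightarrow> real"
  assumes s: "sublinear s"
  obtains f where "linear f" "\<And>x. f x \<le> s x"
proof -
  define A where "A = {r. sublinear r \<and> r \<le> s}"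
  have "\<exists>f\<in>A. \<forall>r\<in>A. r \<le> f \<longrightarrow> r = f"
  proof (rule predicate_Zorn)
    show "partial_order_on A (relation_of (\<lambda>f r. r \<le> f) A)"
      by (rule partial_order_on_relation_ofI) auto
  next
    fix C assume C: "C \<in> Chains (relation_of (\<lambda>f r. r \<le> f) A)"
    have CA: "C \<subseteq> A" and chain: "\<And>f r. f \<in> C \<Longrightarrow> r \<in> C \<Longrightarrow> f \<le> r \<or> r \<le> f"
      using C by (auto simp: Chains_def relation_of_def)
    show "\<exists>u\<in>A. \<forall>r\<in>C. u \<le> r"
    proof (cases "C = {}")
      case True
      then show ?thesis using s by (auto simp: A_def)
    next
      case False
      have "- s (- x) \<le> r x" if "r \<in> C" for r x
      proof -
        have "sublinear r" "r (- x) \<le> s (- x)"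
          using that CA by (auto simp: A_def le_fun_def)
        then show ?thesis using sublinear_minus_le[of r x] by linarith
      qed
      then obtain u where u: "sublinear u" "\<forall>r\<in>C. u \<le> r"
        using sublinear_chain_lower_bound[OF False _ chain, of "\<lambda>x. - s (- x)"] CA
        by (auto simp: A_def)
      moreover have "u \<le> s"
        using False u(2) CA by (auto simp: A_def intro: order_trans)
      ultimately show ?thesis by (auto simp: A_def)
    qed
  qed
  then obtain f where f: "sublinear f" "f \<le> s" and min: "\<And>r. sublinear r \<Longrightarrow> r \<le> f \<Longrightarrow> r = f"
    by (auto simp: A_def)
  have add: "f (x + y) = f x + f y" for x y
  proof -
    obtain r where r: "sublinear r" "\<And>x. r x \<le> f x" "\<And>x. r x \<le> f (x + y) - f y"
      using sublinear_lowering[OF f(1)] by blast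
    then have "r = f" by (intro min) (auto simp: le_fun_def)
    then have "f x \<le> f (x + y) - f y" using r(3) by blast
    then show ?thesis using sublinear_add[OF f(1), of x y] by linarith
  qed
  have minus: "f (- x) = - f x" for x
    using add[of x "- x"] add[of 0 0] by simp
  have pos: "f (t *\<^sub>R x) = t * f x" if "0 \<le> t" for t x
    using sublinear_scaleR[OF f(1) that, of x] sublinear_scaleR[OF f(1) that, of "- x"]
    by (simp add: minus)
  have "f (t *\<^sub>R x) = t * f x" for t x
    using pos[of t x] pos[of "- t" x] minus[of "t *\<^sub>R x"] by (cases "0 \<le> t") auto
  with add have "linear f" by (intro linearI) auto
  then show ?thesis using that f(2) by (auto simp: le_fun_def)
qed

lemma real_norming_functional:
  fixes x :: "'a::real_normed_vector"
  obtains f where "linear f" "\<And>z. \<bar>f z\<bar> \<le> norm z" "f x = norm x"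
proof -
  have "sublinear (norm :: 'a \<Rightarrow> real)"
    by (auto simp: sublinear_def norm_triangle_ineq)
  then obtain r where r: "sublinear r" "\<And>z. r z \<le> norm z" "\<And>z. r z \<le> norm (z + x) - norm x"
    using sublinear_lowering[of norm x] by metis
  then obtain f where f: "linear f" "\<And>z. f z \<le> r z"
    using linear_below_sublinear by blast
  have up: "f z \<le> norm z" for z
    using f(2)[of z] r(2)[of z] by linarith
  have "\<bar>f z\<bar> \<le> norm z" for z
    using up[of z] up[of "- z"] linear_neg[OF f(1), of z] by simp
  moreover have "f x = norm x"
    using f(2)[of "- x"] r(3)[of "- x"] linear_neg[OF f(1), of x] up[of x] by simp
  ultimately show ?thesis using that f(1) by blast
qed

text \<open>
  Real coordinates for the scalar field. The last property of \<open>j\<close> also makes the coordinates unique: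
  apply it to a difference.
\<close>

lemma real_or_complex_cases:
  obtains (real) "\<And>c :: 'k::real_or_complex. \<exists>r. c = of_real r"
  | (complex) j :: "'k::real_or_complex"
    where "j * j = - 1" "\<And>c. \<exists>a b. c = of_real a + j * of_real b"
      "\<And>a b. \<bar>a\<bar> \<le> norm (of_real a + j * of_real b)"
proof -
  obtain h :: "'k \<Rightarrow> complex" where
    add: "\<And>x y. h (x + y) = h x + h y" and mult: "\<And>x y. h (x * y) = h x * h y" and
    scale: "\<And>r x. h (r *\<^sub>R x) = r *\<^sub>R h x" and norm: "\<And>x. norm (h x) = norm x" and
    range: "range h = \<real> \<or> range h = UNIV"
    using real_or_complex by metis
  have lin: "linear h" by (intro linearI) (auto simp: add scale)
  have inj: "x = y" if "h x = h y" for x y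
    using norm[of "x - y"] linear_diff[OF lin, of x y] that by simp
  have "h 1 * h 1 = h 1" "h 1 \<noteq> 0"
    using mult[of 1 1] norm[of 1] by auto
  then have h1: "h 1 = 1" by simp
  have hr: "h (of_real r) = of_real r" for r
    using scale[of r 1] h1 by (simp add: of_real_def)
  from range show ?thesis
  proof
    assume "range h = \<real>"
    then have "\<exists>r. h c = of_real r" for c
      by (metis Reals_cases rangeI)
    then have "\<exists>r. c = of_real r" for c :: 'k
      using hr inj by metis
    then show ?thesis by (rule real)
  next
    assume U: "range h = UNIV"
    obtain j where j: "h j = \<i>"
      using U by (metis UNIV_I imageE)
    have hj: "h (of_real a + j * of_real b) = Complex a b" for a b
      by (simp add: add mult hr j Complex_eq)
    show ?thesis
    proof (rule complex)
      show "j * j = - 1"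
        by (rule inj) (use hr[of "-1"] in \<open>simp add: mult j\<close>)
      show "\<exists>a b. c = of_real a + j * of_real b" for c
        by (rule exI[of _ "Re (h c)"], rule exI[of _ "Im (h c)"], rule inj) (simp add: hj)
      show "\<bar>a\<bar> \<le> norm (of_real a + j * of_real b)" for a b
        using norm[of "of_real a + j * of_real b"] abs_Re_le_cmod[of "Complex a b"] by (simp add: hj)
    qed
  qed
qed

lemma dual_ballI:
  assumes "\<And>x y. F (x + y) = F x + F y" "\<And>c x. F (sX c x) = c * F x"
    "\<And>x. norm (F x) \<le> norm x" "banach_space sX"
  shows "F \<in> dual_ball sX"
proof -
  interpret banach_space sX by fact
  have "bounded_linear F"
  proof (rule bounded_linear_intro[where K=1])
    show "F (r *\<^sub>R x) = r *\<^sub>R F x" for r x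
      using assms(2)[of "of_real r" x] scale_of_real[of r x] by (simp add: scaleR_conv_of_real)
  qed (use assms in auto)
  moreover have "onorm F \<le> 1"
    using onorm_bound[of 1 F] assms(3) by simp
  ultimately show ?thesis using assms(2) by (auto simp: dual_ball_def is_operator_def)
qed

lemma dual_ballD:
  assumes "f \<in> dual_ball sX"
  shows "bounded_linear f" "f (sX c x) = c * f x" "norm (f x) \<le> norm x"
proof -
  show bl: "bounded_linear f" and "f (sX c x) = c * f x"
    using assms by (auto simp: dual_ball_def is_operator_def)
  have "norm (f x) \<le> onorm f * norm x" by (rule onorm[OF bl])
  also have "\<dots> \<le> 1 * norm x"
    using assms by (intro mult_right_mono) (auto simp: dual_ball_def)
  finally show "norm (f x) \<le> norm x" by simp
qed

text \<open>
  Over the complex scalars, a real-linear \<open>f\<close> is the real part of the complex-linear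
  \<open>F z = f z - j f (j z)\<close>, which has the same norm.
\<close>

lemma norming_functional:
  fixes sX :: "'k::real_or_complex \<Rightarrow> 'a::banach \<Rightarrow> 'a"
  assumes X: "banach_space sX"
  obtains f where "f \<in> dual_ball sX" "norm x \<le> norm (f x)"
proof -
  interpret banach_space sX by fact
  obtain f where f: "linear f" "\<And>z. \<bar>f z\<bar> \<le> norm z" "f x = norm x"
    using real_norming_functional[of x] by blast
  have fr: "f (sX (of_real r) z) = r * f z" for r z
    using linear_scale[OF f(1)] by (simp add: scale_of_real)
  show ?thesis
  proof (cases rule: real_or_complex_cases[where 'k='k])
    case real
    let ?F = "\<lambda>z. of_real (f z) :: 'k"
    have "?F (sX c z) = c * ?F z" for c z
      using real[of c] fr by auto
    then have "?F \<in> dual_ball sX"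
      using f(2) by (intro dual_ballI X) (auto simp: linear_add[OF f(1)])
    then show ?thesis using that f(3) by force
  next
    case (complex j)
    define F where "F z = of_real (f z) - j * of_real (f (sX j z))" for z
    have F_add: "F (z + w) = F z + F w" for z w
      by (simp add: F_def scale_right_distrib linear_add[OF f(1)] algebra_simps)
    have F_scale: "F (sX c z) = c * F z" for c z
    proof -
      obtain a b where c: "c = of_real a + j * of_real b" using complex(2) by blast
      have jc: "j * c = of_real (- b) + of_real a * j"
        using complex(1) by (simp add: c algebra_simps flip: mult.assoc)
      have cc: "c = of_real a + of_real b * j" by (simp add: c)
      have 1: "f (sX c z) = a * f z + b * f (sX j z)"
        unfolding cc by (simp add: scale_left_distrib linear_add[OF f(1)] fr flip: scale_scale)
      have "f (sX j (sX c z)) = f (sX (j * c) z)" by simp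
      also have "\<dots> = (- b) * f z + a * f (sX j z)"
        unfolding jc by (simp only: scale_left_distrib linear_add[OF f(1)] fr flip: scale_scale)
      finally have 2: "f (sX j (sX c z)) = - b * f z + a * f (sX j z)" .
      have "c * F z = of_real a * of_real (f z) - (j * j) * (of_real b * of_real (f (sX j z)))
          + j * (of_real b * of_real (f z)) - j * (of_real a * of_real (f (sX j z)))"
        unfolding F_def c by (simp add: algebra_simps)
      also have "\<dots> = F (sX c z)"
        unfolding F_def 1 2 complex(1) by (simp add: algebra_simps)
      finally show ?thesis by simp
    qed
    have F_norm: "norm (F z) \<le> norm z" for z
    proof (cases "F z = 0")
      case False
      \<comment> \<open>Rotating \<open>z\<close> by a unimodular scalar makes \<open>F z\<close> real, and there \<open>F\<close> equals \<open>f\<close>.\<close>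
      define c where "c = of_real (norm (F z)) / F z"
      have nc: "norm c = 1" using False by (simp add: c_def norm_divide)
      have "of_real (norm (F z)) = F (sX c z)"
        using False by (simp add: F_scale c_def)
      then have "of_real (norm (F z)) = of_real (f (sX c z)) - j * of_real (f (sX j (sX c z)))"
        by (simp only: F_def)
      then have "of_real (norm (F z) - f (sX c z)) + j * of_real (f (sX j (sX c z))) = 0"
        by (simp add: algebra_simps)
      then have "norm (F z) = f (sX c z)"
        using complex(3)[of "norm (F z) - f (sX c z)" "f (sX j (sX c z))"] by simp
      also have "\<dots> \<le> norm z" using f(2)[of "sX c z"] nc by (simp add: norm_scale)
      finally show ?thesis .
    qed simp
    have "F \<in> dual_ball sX"
      by (intro dual_ballI X F_add F_scale F_norm)
    moreover have "norm x \<le> norm (F x)"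
      using complex(3)[of "f x" "- f (sX j x)"] f(3) by (simp add: F_def)
    ultimately show ?thesis by (rule that)
  qed
qed

section \<open>Compact sets\<close>

lemma unit_ball_scalars_subset_compact:
  obtains D :: "'k::real_or_complex set" where "compact D" "\<And>c. norm c \<le> 1 \<Longrightarrow> c \<in> D"
proof (cases rule: real_or_complex_cases[where 'k='k])
  case real
  show ?thesis
  proof
    show "compact ((of_real :: real \<Rightarrow> 'k) ` {-1..1})"
      by (intro compact_continuous_image continuous_intros) auto
    show "c \<in> (of_real :: real \<Rightarrow> 'k) ` {-1..1}" if c: "norm c \<le> 1" for c
    proof -
      obtain r where "c = of_real r" using real by blast
      then show ?thesis using c by (intro image_eqI[of _ _ r]) auto
    qed
  qed
next
  case (complex j)
  have nj: "norm j = 1"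
  proof -
    have "norm j * norm j = 1" using complex(1) norm_mult[of j j] by simp
    then show ?thesis
      using square_eq_1_iff[of "norm j"] norm_ge_zero[of j] by auto
  qed
  let ?g = "\<lambda>v :: real \<times> real. of_real (fst v) + j * of_real (snd v)"
  show ?thesis
  proof
    show "compact (?g ` ({-1..1} \<times> {-1..1}))"
      by (intro compact_continuous_image continuous_intros compact_Times) auto
    show "c \<in> ?g ` ({-1..1} \<times> {-1..1})" if c: "norm c \<le> 1" for c
    proof -
      obtain a b where ab: "c = of_real a + j * of_real b" using complex(2) by blast
      \<comment> \<open>Multiplication by \<open>j\<close> exchanges the two coordinates up to sign.\<close>
      have "j * c = of_real (- b) + j * of_real a"
        using complex(1) by (simp add: ab algebra_simps flip: mult.assoc)
      then have "\<bar>- b\<bar> \<le> norm (j * c)" using complex(3)[of "- b" a] by metis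
      then have "\<bar>b\<bar> \<le> 1" using c nj by (simp add: norm_mult)
      moreover have "\<bar>a\<bar> \<le> 1" using complex(3)[of a b] c ab by simp
      ultimately show ?thesis using ab by (intro image_eqI[of _ _ "(a, b)"]) auto
    qed
  qed
qed

lemma compact_combinations:
  fixes y :: "nat \<Rightarrow> 'b::banach" and sY :: "'k::real_or_complex \<Rightarrow> 'b \<Rightarrow> 'b"
  assumes Y: "banach_space sY"
  obtains Z where "compact Z"
    "\<And>c. (\<And>n. n < m \<Longrightarrow> norm (c n) \<le> 1) \<Longrightarrow> (\<Sum>n<(m::nat). sY (c n) (y n)) \<in> Z"
proof -
  interpret banach_space sY by fact
  obtain D :: "'k set" where D: "compact D" "\<And>c. norm c \<le> 1 \<Longrightarrow> c \<in> D"
    using unit_ball_scalars_subset_compact by blast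
  have line: "compact ((\<lambda>c. sY c v) ` D)" for v
  proof (rule compact_continuous_image[OF _ D(1)])
    have "bounded_linear (\<lambda>c. sY c v)"
    proof (rule bounded_linear_intro[where K="norm v"])
      show "sY (r *\<^sub>R c) v = r *\<^sub>R sY c v" for r c
        using scale_of_real[of r "sY c v"] by (simp add: scaleR_conv_of_real)
    qed (simp_all add: scale_left_distrib norm_scale)
    then show "continuous_on D (\<lambda>c. sY c v)" by (rule linear_continuous_on)
  qed
  have "\<exists>Z. compact Z \<and> (\<forall>c. (\<forall>n<m. norm (c n) \<le> 1) \<longrightarrow> (\<Sum>n<(m::nat). sY (c n) (y n)) \<in> Z)"
  proof (induction m)
    case 0
    show ?case by (rule exI[of _ "{0}"]) simp
  next
    case (Suc m)
    then obtain Z where Z: "compact Z"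
      "\<And>c. (\<forall>n<m. norm (c n) \<le> 1) \<Longrightarrow> (\<Sum>n<(m::nat). sY (c n) (y n)) \<in> Z" by blast
    have "compact {u + v | u v. u \<in> Z \<and> v \<in> (\<lambda>c. sY c (y m)) ` D}"
      by (rule compact_sums[OF Z(1) line])
    moreover have "(\<Sum>n<Suc m. sY (c n) (y n)) \<in> {u + v | u v. u \<in> Z \<and> v \<in> (\<lambda>c. sY c (y m)) ` D}"
      if c: "\<forall>n<Suc m. norm (c n) \<le> 1" for c
    proof -
      have "(\<Sum>n<m. sY (c n) (y n)) \<in> Z" "sY (c m) (y m) \<in> (\<lambda>c. sY c (y m)) ` D"
        using c by (auto intro!: Z(2) D(2) imageI)
      then show ?thesis unfolding sum.lessThan_Suc by blast
    qed
    ultimately show ?case by blast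
  qed
  then show ?thesis using that by blast
qed

lemma compact_closure_of_approximation:
  fixes A :: "'b::banach set"
  assumes "\<And>\<epsilon>. 0 < \<epsilon> \<Longrightarrow> \<exists>Z. compact Z \<and> (\<forall>x\<in>A. \<exists>z\<in>Z. dist x z \<le> \<epsilon>)"
  shows "compact (closure A)"
  unfolding compact_eq_totally_bounded
proof (intro conjI allI impI)
  show "complete (closure A)" by (simp add: complete_eq_closed)
  fix \<epsilon> :: real assume \<epsilon>: "0 < \<epsilon>"
  then obtain Z where Z: "compact Z" "\<forall>x\<in>A. \<exists>z\<in>Z. dist x z \<le> \<epsilon> / 4"
    using assms[of "\<epsilon> / 4"] by auto
  obtain k where k: "finite k" "Z \<subseteq> (\<Union>x\<in>k. ball x (\<epsilon> / 4))"
    using Z(1) \<epsilon> unfolding compact_eq_totally_bounded by (meson divide_pos_pos zero_less_numeral)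
  have "x \<in> (\<Union>x\<in>k. ball x \<epsilon>)" if x: "x \<in> closure A" for x
  proof -
    obtain a where a: "a \<in> A" "dist a x < \<epsilon> / 4"
      using x \<epsilon> unfolding closure_approachable by (meson divide_pos_pos zero_less_numeral)
    obtain z where z: "z \<in> Z" "dist a z \<le> \<epsilon> / 4" using Z(2) a(1) by blast
    obtain v where v: "v \<in> k" "dist v z < \<epsilon> / 4" using k(2) z(1) by auto
    have "dist v x \<le> dist v z + dist a z + dist a x"
      by (metis add_right_mono dist_commute dist_triangle dist_triangle_le)
    then show ?thesis using a z v \<epsilon> by (intro UN_I[OF v(1)]) simp
  qed
  then show "\<exists>k. finite k \<and> closure A \<subseteq> (\<Union>x\<in>k. ball x \<epsilon>)" using k(1) by blast
qed

section \<open>Weak norms and partial sums\<close>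

definition partial_lp_norm :: "real \<Rightarrow> nat set \<Rightarrow> (nat \<Rightarrow> 'a::real_normed_vector) \<Rightarrow> real"
  where "partial_lp_norm p F a = (\<Sum>n\<in>F. norm (a n) powr p) powr (1 / p)"

lemma partial_lp_norm_le_iff:
  assumes "0 < p" "0 \<le> C"
  shows "partial_lp_norm p F a \<le> C \<longleftrightarrow> (\<Sum>n\<in>F. norm (a n) powr p) \<le> C powr p"
proof -
  have "0 \<le> (\<Sum>n\<in>F. norm (a n) powr p)" by (intro sum_nonneg) auto
  then show ?thesis
    using assms powr_mono2[of p "(\<Sum>n\<in>F. norm (a n) powr p) powr (1 / p)" C]
      powr_mono2[of "1 / p" "(\<Sum>n\<in>F. norm (a n) powr p)" "C powr p"]
    by (auto simp: partial_lp_norm_def powr_powr)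
qed

text \<open>
  Finite partial sums avoid the case distinction on summability and the extended reals.
\<close>

lemma lp_norm_le_iff:
  fixes a :: "nat \<Rightarrow> 'k::real_normed_vector"
  assumes p: "0 < p" and C: "0 \<le> C"
  shows "lp_norm p a \<le> ennreal C \<longleftrightarrow> (\<forall>F. finite F \<longrightarrow> partial_lp_norm p F a \<le> C)"
    (is "?l \<longleftrightarrow> ?r")
proof
  assume l: ?l
  then have s: "summable (\<lambda>n. norm (a n) powr p)"
    by (auto simp: lp_norm_def top_unique split: if_splits)
  have "(\<Sum>n. norm (a n) powr p) powr (1 / p) \<le> C"
    using l s C by (simp add: lp_norm_def)
  moreover have "partial_lp_norm p F a \<le> (\<Sum>n. norm (a n) powr p) powr (1 / p)" if "finite F" for F
    unfolding partial_lp_norm_def using p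
    by (intro powr_mono2 sum_le_suminf s that sum_nonneg) auto
  ultimately show ?r by (meson order_trans)
next
  assume r: ?r
  have b: "(\<Sum>n\<in>F. norm (a n) powr p) \<le> C powr p" if "finite F" for F
    using r that partial_lp_norm_le_iff[OF p C] by blast
  have s: "summable (\<lambda>n. norm (a n) powr p)"
    by (rule summableI_nonneg_bounded[of _ "C powr p"]) (auto intro: b)
  have "(\<Sum>n. norm (a n) powr p) \<le> C powr p"
    by (rule suminf_le_const[OF s]) (auto intro: b)
  then have "(\<Sum>n. norm (a n) powr p) powr (1 / p) \<le> (C powr p) powr (1 / p)"
    using p s by (intro powr_mono2 suminf_nonneg) auto
  then show ?l using s p C by (simp add: lp_norm_def powr_powr ennreal_leI)
qed

lemma weak_lp_norm_shift_le_iff: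
  assumes p: "0 < p" and C: "0 \<le> C"
  shows "weak_lp_norm p sX (\<lambda>n. x (n + m)) \<le> ennreal C \<longleftrightarrow>
    (\<forall>f\<in>dual_ball sX. \<forall>F. finite F \<and> F \<subseteq> {m..} \<longrightarrow> partial_lp_norm p F (\<lambda>n. f (x n)) \<le> C)"
proof -
  have eq: "partial_lp_norm p F (\<lambda>n. g (n + m)) = partial_lp_norm p ((\<lambda>n. n + m) ` F) g"
    for F and g :: "nat \<Rightarrow> 'a"
    by (simp add: partial_lp_norm_def sum.reindex)
  have im: "\<exists>G. finite G \<and> F = (\<lambda>n. n + m) ` G" if "finite F" "F \<subseteq> {m..}" for F :: "nat set"
    using that by (intro exI[of _ "(\<lambda>n. n - m) ` F"]) (force simp: image_image)
  have sub: "(\<lambda>n. n + m) ` F \<subseteq> {m..}" for F :: "nat set" by auto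
  show ?thesis
    unfolding weak_lp_norm_def SUP_le_iff lp_norm_le_iff[OF p C] eq[of _ "\<lambda>n. f (x n)" for f]
    using im sub by (metis finite_imageI)
qed

section \<open>Sequence spaces in duality\<close>

text \<open>
  What is used of the pair of a sequence space \<open>L\<close> with norm \<open>N\<close> (either \<open>l\<close> with the exponent
  conjugate to \<open>p\<close>, or \<open>c\<^sub>0\<close> for \<open>p = 1\<close>) and the space \<open>l\<^sub>p\<close>: Hoelder's inequality, its sharpness,
  density of the finitely supported sequences, and that sums of disjoint blocks from the unit ball
  grow more slowly than the number of blocks. The last property replaces the fact that disjoint
  blocks converge weakly to \<open>0\<close>; in \<open>l\<^sub>1\<close> it fails.
\<close>

locale sequence_duality =
  fixes p :: real and L :: "(nat \<Rightarrow> 'k::real_or_complex) set" and N :: "(nat \<Rightarrow> 'k) \<Rightarrow> real"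
  assumes p_pos: "0 < p"
    and add_mem: "a \<in> L \<Longrightarrow> b \<in> L \<Longrightarrow> (\<lambda>n. a n + b n) \<in> L"
    and scale_mem: "a \<in> L \<Longrightarrow> (\<lambda>n. c * a n) \<in> L"
    and finite_support_mem: "finite F \<Longrightarrow> (\<And>n. n \<notin> F \<Longrightarrow> a n = 0) \<Longrightarrow> a \<in> L"
    and hoelder: "a \<in> L \<Longrightarrow> finite F \<Longrightarrow> norm (\<Sum>n\<in>F. a n * b n) \<le> N a * partial_lp_norm p F b"
    and hoelder_sharp: "finite F \<Longrightarrow> \<exists>a. (\<forall>n. n \<notin> F \<longrightarrow> a n = 0) \<and> N a \<le> 1 \<and>
      (\<Sum>n\<in>F. a n * b n) = of_real (partial_lp_norm p F b)"
    and tail_tendsto: "a \<in> L \<Longrightarrow> (\<lambda>m. N (\<lambda>n. if n < m then 0 else a n)) \<longlonglongrightarrow> 0"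
    and disjoint_blocks: "0 < \<delta> \<Longrightarrow> \<exists>k>0. \<forall>b. (\<forall>i. b i \<in> L \<and> N (b i) \<le> 1) \<and>
      (\<forall>i j n. i \<noteq> j \<longrightarrow> b i n = 0 \<or> b j n = 0) \<longrightarrow> N (\<lambda>n. \<Sum>i<k. b i n) \<le> \<delta> * real k"
begin

lemma norm_component_le: "a \<in> L \<Longrightarrow> norm (a n) \<le> N a"
  using hoelder[of a "{n}" "\<lambda>_. 1"] by (simp add: partial_lp_norm_def)

lemma N_nonneg: "a \<in> L \<Longrightarrow> 0 \<le> N a"
  by (rule order_trans[OF norm_ge_zero norm_component_le[of _ 0]])

lemma tail_mem:
  assumes "a \<in> L" shows "(\<lambda>n. if n < m then 0 else a n) \<in> L"
proof -
  have "(\<lambda>n. if n < m then - a n else 0) \<in> L"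
    by (rule finite_support_mem[of "{..<m}"]) auto
  from add_mem[OF assms this] show ?thesis
    by (rule back_subst[of "\<lambda>f. f \<in> L"]) auto
qed

lemma sum_mem: "(\<And>i. i < k \<Longrightarrow> b i \<in> L) \<Longrightarrow> (\<lambda>n. \<Sum>i<(k::nat). b i n) \<in> L"
proof (induction k)
  case 0
  then show ?case by (intro finite_support_mem[of "{}"]) auto
next
  case (Suc k)
  then show ?case using add_mem[of "\<lambda>n. \<Sum>i<k. b i n" "b k"] by simp
qed

text \<open>
  Hoelder's inequality, applied after a functional norming the vector sum, turns the weak norm of a
  tail into a bound for the linear combinations of that tail.
\<close>

lemma norm_combination_le:
  assumes X: "banach_space sX" and C: "0 \<le> C"
    and w: "weak_lp_norm p sX (\<lambda>n. x (n + m)) \<le> ennreal C"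
    and a: "a \<in> L" and F: "finite F" "F \<subseteq> {m..}"
  shows "norm (\<Sum>n\<in>F. sX (a n) (x n)) \<le> N a * C"
proof -
  obtain f where f: "f \<in> dual_ball sX"
    and le: "norm (\<Sum>n\<in>F. sX (a n) (x n)) \<le> norm (f (\<Sum>n\<in>F. sX (a n) (x n)))"
    using norming_functional[OF X] by blast
  have "f (\<Sum>n\<in>F. sX (a n) (x n)) = (\<Sum>n\<in>F. a n * f (x n))"
    by (simp add: linear_sum[OF bounded_linear.linear[OF dual_ballD(1)[OF f]]] dual_ballD(2)[OF f])
  also have "norm \<dots> \<le> N a * partial_lp_norm p F (\<lambda>n. f (x n))"
    by (rule hoelder[OF a F(1)])
  also have "\<dots> \<le> N a * C"
    using w weak_lp_norm_shift_le_iff[OF p_pos C, of sX x m] f F N_nonneg[OF a]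
    by (intro mult_left_mono) auto
  finally show ?thesis using le by simp
qed

text \<open>
  Conversely, the coefficients for which Hoelder's inequality is sharp recover the weak norm of a
  tail from its linear combinations. Together with the preceding lemma this expresses weak norms
  without functionals.
\<close>

lemma weak_lp_norm_le:
  assumes C: "0 \<le> C"
    and *: "\<And>a F. finite F \<Longrightarrow> F \<subseteq> {m..} \<Longrightarrow> (\<And>n. n \<notin> F \<Longrightarrow> a n = 0) \<Longrightarrow> N a \<le> 1 \<Longrightarrow>
      norm (\<Sum>n\<in>F. sX (a n) (x n)) \<le> C"
  shows "weak_lp_norm p sX (\<lambda>n. x (n + m)) \<le> ennreal C"
  unfolding weak_lp_norm_shift_le_iff[OF p_pos C]
proof (intro ballI allI impI)
  fix f F assume f: "f \<in> dual_ball sX" and F: "finite F \<and> F \<subseteq> {m..}"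
  obtain a where a: "\<forall>n. n \<notin> F \<longrightarrow> a n = 0" "N a \<le> 1"
    "(\<Sum>n\<in>F. a n * f (x n)) = of_real (partial_lp_norm p F (\<lambda>n. f (x n)))"
    using hoelder_sharp[of F "\<lambda>n. f (x n)"] F by blast
  have "f (\<Sum>n\<in>F. sX (a n) (x n)) = of_real (partial_lp_norm p F (\<lambda>n. f (x n)))"
    using a(3)
    by (simp add: linear_sum[OF bounded_linear.linear[OF dual_ballD(1)[OF f]]] dual_ballD(2)[OF f])
  then have "partial_lp_norm p F (\<lambda>n. f (x n)) \<le> norm (\<Sum>n\<in>F. sX (a n) (x n))"
    using dual_ballD(3)[OF f, of "\<Sum>n\<in>F. sX (a n) (x n)"] by simp
  also have "\<dots> \<le> C" using * F a by blast
  finally show "partial_lp_norm p F (\<lambda>n. f (x n)) \<le> C" .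
qed

lemma weak_lp_norm_tail_mono:
  assumes "0 \<le> C" "weak_lp_norm p sX (\<lambda>n. x (n + m)) \<le> ennreal C" "m \<le> k"
  shows "weak_lp_norm p sX (\<lambda>n. x (n + k)) \<le> ennreal C"
  using assms(2,3) unfolding weak_lp_norm_shift_le_iff[OF p_pos assms(1)]
  by (meson atLeast_subset_iff subset_trans)

text \<open>
  The weak norms of the tails decrease, so that one small tail suffices for convergence to \<open>0\<close>.
\<close>

lemma uncond_p_summable_iff:
  "x \<in> uncond_p_summable p sX \<longleftrightarrow> x \<in> weakly_p_summable p sX \<and>
    (\<forall>\<epsilon>>0. \<exists>m. weak_lp_norm p sX (\<lambda>n. x (n + m)) \<le> ennreal \<epsilon>)"
proof -
  have "(\<lambda>m. weak_lp_norm p sX (\<lambda>n. x (n + m))) \<longlonglongrightarrow> 0 \<longleftrightarrow>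
    (\<forall>\<epsilon>>0. \<exists>m. weak_lp_norm p sX (\<lambda>n. x (n + m)) \<le> ennreal \<epsilon>)" (is "?w \<longlonglongrightarrow> 0 \<longleftrightarrow> ?r")
  proof
    assume lim: "?w \<longlonglongrightarrow> 0"
    show ?r
    proof (intro allI impI)
      fix \<epsilon> :: real assume "0 < \<epsilon>"
      then have "\<forall>\<^sub>F m in sequentially. ?w m < ennreal \<epsilon>"
        by (intro order_tendstoD(2)[OF lim]) simp
      then show "\<exists>m. ?w m \<le> ennreal \<epsilon>"
        by (meson eventually_sequentially order_refl less_imp_le)
    qed
  next
    assume r: ?r
    show "?w \<longlonglongrightarrow> 0"
    proof (rule order_tendstoI)
      fix a :: ennreal assume "0 < a"
      then obtain b where b: "0 < b" "b < a" using dense by blast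
      then obtain \<epsilon> where \<epsilon>: "b = ennreal \<epsilon>" "0 < \<epsilon>"
        by (cases b) auto
      obtain m where "?w m \<le> ennreal \<epsilon>" using r \<epsilon>(2) by blast
      then have "?w k < a" if "m \<le> k" for k
        using weak_lp_norm_tail_mono[of \<epsilon> sX x m k] that b \<epsilon> by (simp add: le_less_trans)
      then show "\<forall>\<^sub>F m in sequentially. ?w m < a" by (auto simp: eventually_sequentially)
    qed simp
  qed
  then show ?thesis by (auto simp: uncond_p_summable_def)
qed

lemma weakly_p_summableE:
  assumes "x \<in> weakly_p_summable p sX"
  obtains W where "0 \<le> W" "weak_lp_norm p sX (\<lambda>n. x (n + 0)) \<le> ennreal W"
  using assms by (cases "weak_lp_norm p sX x") (auto simp: weakly_p_summable_def)

end

section \<open>Operators on the sequence space\<close>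

context
  fixes L :: "(nat \<Rightarrow> 'k::real_or_complex) set" and N and sX :: "'k \<Rightarrow> 'a::banach \<Rightarrow> 'a" and S
  assumes S: "is_seq_operator L N sX S"
begin

lemma seq_operator_add: "a \<in> L \<Longrightarrow> b \<in> L \<Longrightarrow> S (\<lambda>n. a n + b n) = S a + S b"
  and seq_operator_scale: "a \<in> L \<Longrightarrow> S (\<lambda>n. c * a n) = sX c (S a)"
  using S by (auto simp: is_seq_operator_def)

end

lemma (in sequence_duality) seq_operator_bound:
  assumes "is_seq_operator L N sX S"
  obtains K where "0 < K" "\<And>a. a \<in> L \<Longrightarrow> norm (S a) \<le> K * N a"
proof -
  obtain K where K: "\<And>a. a \<in> L \<Longrightarrow> norm (S a) \<le> K * N a"
    using assms unfolding is_seq_operator_def by blast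
  have "norm (S a) \<le> max K 1 * N a" if "a \<in> L" for a
    using K[OF that] N_nonneg[OF that] mult_right_mono[of K "max K 1" "N a"] by linarith
  then show ?thesis using that[of "max K 1"] by simp
qed

context sequence_duality
begin

lemma seq_operator_sum:
  assumes X: "banach_space sX" and S: "is_seq_operator L N sX S"
    and b: "\<And>i. i < k \<Longrightarrow> b i \<in> L"
  shows "S (\<lambda>n. \<Sum>i<k. b i n) = (\<Sum>i<(k::nat). S (b i))"
  using b
proof (induction k)
  case 0
  interpret banach_space sX by fact
  have "(\<lambda>n. 0) \<in> L" by (rule finite_support_mem[of "{}"]) auto
  then show ?case using seq_operator_scale[OF S, of "\<lambda>n. 0" 0] by simp
next
  case (Suc k)
  then show ?case
    using seq_operator_add[OF S sum_mem, of k b "b k"] by simp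
qed

lemma seq_operator_finite_support:
  assumes X: "banach_space sX" and S: "is_seq_operator L N sX S"
    and a: "\<And>n. k \<le> n \<Longrightarrow> a n = 0"
  shows "S a = (\<Sum>n<k. sX (a n) (S (\<lambda>j. if j = n then 1 else 0)))"
proof -
  have e: "(\<lambda>j. if j = n then 1 else 0) \<in> L" for n
    by (rule finite_support_mem[of "{n}"]) auto
  have "a = (\<lambda>j. \<Sum>n<k. a n * (if j = n then 1 else 0))"
  proof
    show "a j = (\<Sum>n<k. a n * (if j = n then 1 else 0))" for j
      using a[of j] by (cases "j < k") (auto simp: if_distrib cong: if_cong)
  qed
  then have "S a = S (\<lambda>j. \<Sum>n<k. a n * (if j = n then 1 else 0))" by (rule arg_cong)
  also have "\<dots> = (\<Sum>n<k. S (\<lambda>j. a n * (if j = n then 1 else 0)))"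
    by (rule seq_operator_sum[OF X S scale_mem[OF e]])
  finally show ?thesis by (simp only: seq_operator_scale[OF S e])
qed

lemma is_seq_operator_compose:
  assumes "is_operator sX sY T" and S: "is_seq_operator L N sX S"
  shows "is_seq_operator L N sY (T \<circ> S)"
proof -
  interpret T: bounded_linear T using assms by (auto simp: is_operator_def)
  have lin: "T (sX c x) = sY c (T x)" for c x
    using assms by (auto simp: is_operator_def)
  obtain K where K: "\<And>a. a \<in> L \<Longrightarrow> norm (S a) \<le> K * N a"
    using S unfolding is_seq_operator_def by blast
  obtain B where B: "0 < B" "\<And>x. norm (T x) \<le> norm x * B"
    using T.pos_bounded by blast
  have "norm (T (S a)) \<le> (K * B) * N a" if "a \<in> L" for a
  proof -
    have "norm (T (S a)) \<le> norm (S a) * B" by (rule B(2))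
    also have "\<dots> \<le> (K * N a) * B" using K[OF that] B(1) by (intro mult_right_mono) auto
    finally show ?thesis by (simp add: mult_ac)
  qed
  then show ?thesis
    using seq_operator_add[OF S] seq_operator_scale[OF S]
    by (auto simp: is_seq_operator_def T.add lin)
qed

section \<open>The two implications\<close>

text \<open>
  Let \<open>x\<close> be the image of the unit vectors under \<open>S\<close>. Once the weak norm of the tail of \<open>T x\<close> from
  \<open>m\<close> on is at most \<open>\<epsilon>\<close>, truncating a sequence in the unit ball after \<open>m\<close> terms changes its image
  under \<open>T S\<close> by at most \<open>\<epsilon>\<close>, and the images of the truncated sequences stay in a compact set.
\<close>

lemma compact_of_uncond_p_converging:
  assumes X: "banach_space sX" and Y: "banach_space sY" and T: "is_operator sX sY T"
    and conv: "uncond_p_converging p sX sY T" and S: "is_seq_operator L N sX S"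
  shows "is_compact_seq_operator L N sY (T \<circ> S)"
proof -
  define x where "x n = S (\<lambda>j. if j = n then 1 else 0)" for n
  obtain K where K: "0 < K" "\<And>a. a \<in> L \<Longrightarrow> norm (S a) \<le> K * N a"
    using seq_operator_bound[OF S] by blast
  have "norm (\<Sum>n\<in>F. sX (a n) (x n)) \<le> K"
    if F: "finite F" and a: "\<And>n. n \<notin> F \<Longrightarrow> a n = 0" "N a \<le> 1" for F a
  proof -
    interpret banach_space sX by fact
    obtain k where k: "F \<subseteq> {..<k}" using F finite_nat_bounded by blast
    have "S a = (\<Sum>n<k. sX (a n) (x n))"
      unfolding x_def using a k by (intro seq_operator_finite_support[OF X S]) force
    also have "\<dots> = (\<Sum>n\<in>F. sX (a n) (x n))"
      using k a by (intro sum.mono_neutral_right) auto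
    finally have "norm (\<Sum>n\<in>F. sX (a n) (x n)) = norm (S a)" by simp
    also have "\<dots> \<le> K * N a" by (intro K finite_support_mem[OF F] a)
    also have "\<dots> \<le> K" using a(2) K(1) by simp
    finally show ?thesis .
  qed
  then have "weak_lp_norm p sX (\<lambda>n. x (n + 0)) \<le> ennreal K"
    using K(1) by (intro weak_lp_norm_le) auto
  then have "x \<in> weakly_p_summable p sX"
    by (auto simp: weakly_p_summable_def intro: le_less_trans)
  then have uncond: "(\<lambda>n. T (x n)) \<in> uncond_p_summable p sY"
    using conv by (auto simp: uncond_p_converging_def)
  have TS: "is_seq_operator L N sY (T \<circ> S)"
    by (rule is_seq_operator_compose[OF T S])
  obtain B where B: "0 < B" "\<And>a. a \<in> L \<Longrightarrow> norm ((T \<circ> S) a) \<le> B * N a"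
    using seq_operator_bound[OF TS] by blast
  have "compact (closure ((T \<circ> S) ` {a \<in> L. N a \<le> 1}))"
  proof (rule compact_closure_of_approximation)
    fix \<epsilon> :: real assume \<epsilon>: "0 < \<epsilon>"
    obtain m where m: "weak_lp_norm p sY (\<lambda>n. T (x (n + m))) \<le> ennreal \<epsilon>"
      using uncond \<epsilon> uncond_p_summable_iff[of "\<lambda>n. T (x n)"] by auto
    obtain Z where Z: "compact Z"
      "\<And>c. (\<And>n. n < m \<Longrightarrow> norm (c n) \<le> 1) \<Longrightarrow> (\<Sum>n<m. sY (c n) (T (x n))) \<in> Z"
      using compact_combinations[OF Y] by metis
    have "dist ((T \<circ> S) a) (\<Sum>n<m. sY (a n) (T (x n))) \<le> \<epsilon>"
      if a: "a \<in> L" "N a \<le> 1" for a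
    proof (rule field_le_epsilon)
      fix e :: real assume e: "0 < e"
      have "(\<lambda>k. B * N (\<lambda>n. if n < k then 0 else a n)) \<longlonglongrightarrow> B * 0"
        by (intro tendsto_intros tail_tendsto a)
      then have "\<forall>\<^sub>F k in sequentially. B * N (\<lambda>n. if n < k then 0 else a n) < e"
        using e by (intro order_tendstoD(2)) auto
      then obtain k where k: "m \<le> k" "B * N (\<lambda>n. if n < k then 0 else a n) < e"
        unfolding eventually_sequentially by (meson nat_le_linear order_refl)
      define h where "h n = (if n < k then a n else 0)" for n
      have h: "h \<in> L" by (rule finite_support_mem[of "{..<k}"]) (auto simp: h_def)
      have "a = (\<lambda>n. h n + (if n < k then 0 else a n))" by (auto simp: h_def)
      then have "(T \<circ> S) a = (T \<circ> S) (\<lambda>n. h n + (if n < k then 0 else a n))" by (rule arg_cong)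
      also have "\<dots> = (T \<circ> S) h + (T \<circ> S) (\<lambda>n. if n < k then 0 else a n)"
        by (rule seq_operator_add[OF TS h tail_mem[OF a(1)]])
      also have "(T \<circ> S) h = (\<Sum>n<k. sY (h n) ((T \<circ> S) (\<lambda>j. if j = n then 1 else 0)))"
        by (rule seq_operator_finite_support[OF Y TS]) (simp add: h_def)
      also have "\<dots> = (\<Sum>n<k. sY (a n) (T (x n)))"
        by (intro sum.cong) (auto simp: x_def h_def)
      also have "\<dots> = (\<Sum>n<m. sY (a n) (T (x n))) + (\<Sum>n\<in>{m..<k}. sY (a n) (T (x n)))"
        using k(1) by (simp add: lessThan_atLeast0 sum.atLeastLessThan_concat)
      finally have "(T \<circ> S) a - (\<Sum>n<m. sY (a n) (T (x n))) =
        (\<Sum>n\<in>{m..<k}. sY (a n) (T (x n))) + (T \<circ> S) (\<lambda>n. if n < k then 0 else a n)"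
        by simp
      then have "dist ((T \<circ> S) a) (\<Sum>n<m. sY (a n) (T (x n))) \<le>
        norm (\<Sum>n\<in>{m..<k}. sY (a n) (T (x n))) + norm ((T \<circ> S) (\<lambda>n. if n < k then 0 else a n))"
        unfolding dist_norm by (simp only: norm_triangle_ineq)
      moreover have "norm (\<Sum>n\<in>{m..<k}. sY (a n) (T (x n))) \<le> N a * \<epsilon>"
        using \<epsilon> m by (intro norm_combination_le[OF Y _ _ a(1)]) auto
      moreover have "N a * \<epsilon> \<le> \<epsilon>" using a(2) \<epsilon> by simp
      moreover have "norm ((T \<circ> S) (\<lambda>n. if n < k then 0 else a n)) < e"
        using B(2)[OF tail_mem[OF a(1)], of k] k(2) by simp
      ultimately show "dist ((T \<circ> S) a) (\<Sum>n<m. sY (a n) (T (x n))) \<le> \<epsilon> + e"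
        by linarith
    qed
    moreover have "(\<Sum>n<m. sY (a n) (T (x n))) \<in> Z" if "a \<in> L" "N a \<le> 1" for a
      using norm_component_le[OF that(1)] that(2) by (intro Z(2)) (meson order_trans)
    ultimately show "\<exists>Z. compact Z \<and> (\<forall>y\<in>(T \<circ> S) ` {a \<in> L. N a \<le> 1}. \<exists>z\<in>Z. dist y z \<le> \<epsilon>)"
      using Z(1) by blast
  qed
  then show ?thesis using TS by (simp add: is_compact_seq_operator_def)
qed

text \<open>
  The operator is \<open>S a = \<Sum>n. a n x n\<close>. Its partial sums are Cauchy by Hoelder's inequality because
  the tails of \<open>a\<close> tend to \<open>0\<close> in the norm of \<open>L\<close>.
\<close>

lemma weakly_p_summable_operator:
  assumes X: "banach_space sX" and x: "x \<in> weakly_p_summable p sX"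
  obtains S where "is_seq_operator L N sX S"
    "\<And>a F. finite F \<Longrightarrow> (\<And>n. n \<notin> F \<Longrightarrow> a n = 0) \<Longrightarrow> S a = (\<Sum>n\<in>F. sX (a n) (x n))"
proof -
  interpret banach_space sX by fact
  obtain W where W: "0 \<le> W" "weak_lp_norm p sX (\<lambda>n. x (n + 0)) \<le> ennreal W"
    using weakly_p_summableE[OF x] by blast
  define S where "S a = (\<Sum>n. sX (a n) (x n))" for a
  have bound: "norm (\<Sum>n\<in>F. sX (a n) (x n)) \<le> N a * W" if "a \<in> L" "finite F" for a F
    by (rule norm_combination_le[OF X W that]) auto
  have summable: "summable (\<lambda>n. sX (a n) (x n))" if a: "a \<in> L" for a
    unfolding summable_Cauchy
  proof (intro allI impI)
    fix e :: real assume e: "0 < e"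
    have "(\<lambda>k. N (\<lambda>n. if n < k then 0 else a n) * W) \<longlonglongrightarrow> 0 * W"
      by (intro tendsto_intros tail_tendsto a)
    then have "\<forall>\<^sub>F k in sequentially. N (\<lambda>n. if n < k then 0 else a n) * W < e"
      using e by (intro order_tendstoD(2)) auto
    then obtain M where M: "\<And>k. M \<le> k \<Longrightarrow> N (\<lambda>n. if n < k then 0 else a n) * W < e"
      by (auto simp: eventually_sequentially)
    have "norm (sum (\<lambda>n. sX (a n) (x n)) {m..<n}) < e" if "M \<le> m" for m n
    proof -
      have "(\<Sum>n\<in>{m..<n}. sX (a n) (x n)) = (\<Sum>n\<in>{m..<n}. sX (if n < m then 0 else a n) (x n))"
        by (intro sum.cong) auto
      also have "norm \<dots> \<le> N (\<lambda>n. if n < m then 0 else a n) * W"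
        by (rule bound[OF tail_mem[OF a]]) simp
      also have "\<dots> < e" by (rule M[OF that])
      finally show ?thesis .
    qed
    then show "\<exists>M. \<forall>m\<ge>M. \<forall>n. norm (sum (\<lambda>n. sX (a n) (x n)) {m..<n}) < e" by blast
  qed
  have "is_seq_operator L N sX S"
    unfolding is_seq_operator_def
  proof (intro conjI allI ballI exI)
    show "S (\<lambda>n. a n + b n) = S a + S b" if "a \<in> L" "b \<in> L" for a b
      unfolding S_def using suminf_add[OF summable summable, OF that] by (simp add: scale_left_distrib)
    show "S (\<lambda>n. c * a n) = sX c (S a)" if "a \<in> L" for c a
    proof -
      have "bounded_linear (sX c)"
      proof (rule bounded_linear_intro[where K="norm c"])
        show "sX c (r *\<^sub>R z) = r *\<^sub>R sX c z" for r z
          by (metis scale_of_real scale_left_commute)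
      qed (simp_all add: scale_right_distrib norm_scale mult.commute)
      from bounded_linear.suminf[OF this summable[OF that]] show ?thesis
        by (simp add: S_def)
    qed
    show "norm (S a) \<le> W * N a" if "a \<in> L" for a
    proof (rule tendsto_upperbound)
      show "(\<lambda>k. norm (\<Sum>n<k. sX (a n) (x n))) \<longlonglongrightarrow> norm (S a)"
        unfolding S_def by (intro tendsto_norm summable_LIMSEQ summable that)
      show "\<forall>\<^sub>F k in sequentially. norm (\<Sum>n<k. sX (a n) (x n)) \<le> W * N a"
        using bound[OF that] by (simp add: mult.commute)
    qed simp
  qed
  moreover have "S a = (\<Sum>n\<in>F. sX (a n) (x n))" if "finite F" "\<And>n. n \<notin> F \<Longrightarrow> a n = 0" for a F
    unfolding S_def using that by (intro suminf_finite) auto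
  ultimately show ?thesis by (rule that)
qed

text \<open>
  By compactness, infinitely many of the images \<open>R (b i)\<close> cluster at one vector \<open>y\<close>, with
  \<open>norm y > \<epsilon> / 2\<close>. The sum of \<open>k\<close> of them is then close to \<open>k y\<close>, so that its norm grows linearly
  in \<open>k\<close>, whereas the norm of the sum of \<open>k\<close> disjoint blocks does not.
\<close>

lemma compact_disjoint_blocks_contradiction:
  assumes Y: "banach_space sY" and R: "is_compact_seq_operator L N sY R"
    and b: "\<And>i. b i \<in> L" "\<And>i. N (b i) \<le> 1"
    and disj: "\<And>i j n. i \<noteq> j \<Longrightarrow> b i n = 0 \<or> b j n = 0"
    and \<epsilon>: "0 < \<epsilon>" "\<And>i::nat. \<epsilon> < norm (R (b i))"
  shows False
proof -
  have op: "is_seq_operator L N sY R" and cpt: "compact (closure (R ` {a \<in> L. N a \<le> 1}))"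
    using R by (auto simp: is_compact_seq_operator_def)
  obtain K where K: "0 < K" "\<And>a. a \<in> L \<Longrightarrow> norm (R a) \<le> K * N a"
    using seq_operator_bound[OF op] by blast
  have "R (b i) \<in> closure (R ` {a \<in> L. N a \<le> 1})" for i
    using b by (intro subsetD[OF closure_subset]) auto
  then have "\<exists>y\<in>closure (R ` {a \<in> L. N a \<le> 1}). \<exists>r. strict_mono r \<and> ((\<lambda>i. R (b i)) \<circ> r) \<longlonglongrightarrow> y"
    using cpt[unfolded compact_def, rule_format, of "\<lambda>i. R (b i)"] by blast
  then obtain y r where r: "strict_mono r" "((\<lambda>i. R (b i)) \<circ> r) \<longlonglongrightarrow> y"
    by blast
  obtain k where k: "k > 0" and blocks: "\<And>b. (\<forall>i. b i \<in> L \<and> N (b i) \<le> 1) \<Longrightarrow>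
      (\<forall>i j n. i \<noteq> j \<longrightarrow> b i n = 0 \<or> b j n = 0) \<Longrightarrow> N (\<lambda>n. \<Sum>i<k. b i n) \<le> \<epsilon> / (4 * K) * real k"
    using disjoint_blocks[of "\<epsilon> / (4 * K)"] \<epsilon>(1) K(1) by auto
  obtain M where M: "\<And>i. M \<le> i \<Longrightarrow> norm (R (b (r i)) - y) < \<epsilon> / 4"
    using LIMSEQ_D[OF r(2), of "\<epsilon> / 4"] \<epsilon>(1) by auto
  define d where "d i = b (r (M + i))" for i
  have inj: "r (M + i) \<noteq> r (M + j)" if "i \<noteq> j" for i j
    using strict_mono_eq[OF r(1)] that by simp
  have d: "d i \<in> L" "N (d i) \<le> 1" "norm (R (d i) - y) < \<epsilon> / 4" for i
    using b M[of "M + i"] by (auto simp: d_def)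
  have "N (\<lambda>n. \<Sum>i<k. d i n) \<le> \<epsilon> / (4 * K) * real k"
    by (rule blocks) (use d(1,2) disj[OF inj] in \<open>auto simp: d_def\<close>)
  then have "norm (R (\<lambda>n. \<Sum>i<k. d i n)) \<le> K * (\<epsilon> / (4 * K) * real k)"
    using K(1) by (intro order_trans[OF K(2)[OF sum_mem[OF d(1)]]] mult_left_mono) auto
  then have up: "norm (\<Sum>i<k. R (d i)) \<le> real k * (\<epsilon> / 4)"
    using K(1) seq_operator_sum[OF Y op, of k d] d(1) by (simp add: mult.commute)
  have "norm (\<Sum>i<k. R (d i) - y) \<le> real k * (\<epsilon> / 4)"
    using sum_norm_bound[of "{..<k}" "\<lambda>i. R (d i) - y" "\<epsilon> / 4"] d(3) by (simp add: less_imp_le)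
  then have "norm ((\<Sum>i<k. R (d i)) - real k *\<^sub>R y) \<le> real k * (\<epsilon> / 4)"
    by (simp add: sum_subtractf sum_constant_scaleR)
  with up have "norm (real k *\<^sub>R y) \<le> real k * (\<epsilon> / 4) + real k * (\<epsilon> / 4)"
    using norm_triangle_sub[of "real k *\<^sub>R y" "\<Sum>i<k. R (d i)"]
      norm_minus_commute[of "real k *\<^sub>R y" "\<Sum>i<k. R (d i)"] by linarith
  then have "real k * norm y \<le> real k * (\<epsilon> / 2)" by (simp add: mult.commute)
  then have "norm y \<le> \<epsilon> / 2" using k by simp
  then show False
    using \<epsilon>(2)[of "r M"] M[of M] \<epsilon>(1) norm_triangle_sub[of "R (b (r M))" y] by simp
qed

text \<open>
  Represent \<open>x\<close> by an operator \<open>S\<close>. If the tails of \<open>T x\<close> do not become weakly small, then for every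
  \<open>m\<close> there is a vector of the unit ball of \<open>L\<close>, finitely supported beyond \<open>m\<close>, with large image
  under \<open>T S\<close>; disjoint ones among them contradict the compactness of \<open>T S\<close>.
\<close>

lemma uncond_p_converging_of_compact:
  assumes X: "banach_space sX" and Y: "banach_space sY" and T: "is_operator sX sY T"
    and cpt: "\<And>S. is_seq_operator L N sX S \<Longrightarrow> is_compact_seq_operator L N sY (T \<circ> S)"
  shows "uncond_p_converging p sX sY T"
  unfolding uncond_p_converging_def
proof
  fix x assume x: "x \<in> weakly_p_summable p sX"
  interpret T: bounded_linear T using T by (auto simp: is_operator_def)
  obtain S where S: "is_seq_operator L N sX S"
    and S_fin: "\<And>a F. finite F \<Longrightarrow> (\<And>n. n \<notin> F \<Longrightarrow> a n = 0) \<Longrightarrow> S a = (\<Sum>n\<in>F. sX (a n) (x n))"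
    using weakly_p_summable_operator[OF X x] by blast
  have TS: "is_compact_seq_operator L N sY (T \<circ> S)" by (rule cpt[OF S])
  then have op: "is_seq_operator L N sY (T \<circ> S)" by (simp add: is_compact_seq_operator_def)
  have fin: "(\<Sum>n\<in>F. sY (a n) (T (x n))) = (T \<circ> S) a" if "finite F" "\<And>n. n \<notin> F \<Longrightarrow> a n = 0" for a F
    using S_fin[OF that] T by (simp add: T.sum is_operator_def)
  obtain K where K: "0 < K" "\<And>a. a \<in> L \<Longrightarrow> norm ((T \<circ> S) a) \<le> K * N a"
    using seq_operator_bound[OF op] by blast
  have "weak_lp_norm p sY (\<lambda>n. T (x (n + 0))) \<le> ennreal K"
  proof (rule weak_lp_norm_le)
    fix a F assume F: "finite F" and a: "\<And>n. n \<notin> F \<Longrightarrow> a n = 0" "N a \<le> 1"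
    have "norm ((T \<circ> S) a) \<le> K * N a" by (intro K finite_support_mem[OF F] a)
    also have "\<dots> \<le> K" using a(2) K(1) by simp
    finally show "norm (\<Sum>n\<in>F. sY (a n) (T (x n))) \<le> K" using fin[OF F a(1)] by simp
  qed (use K in simp)
  then have weak: "(\<lambda>n. T (x n)) \<in> weakly_p_summable p sY"
    by (auto simp: weakly_p_summable_def intro: le_less_trans)
  have "\<exists>m. weak_lp_norm p sY (\<lambda>n. T (x (n + m))) \<le> ennreal \<epsilon>" if \<epsilon>: "0 < \<epsilon>" for \<epsilon>
  proof (rule ccontr)
    assume neg: "\<nexists>m. weak_lp_norm p sY (\<lambda>n. T (x (n + m))) \<le> ennreal \<epsilon>"
    have "\<exists>a k. (\<forall>n. n \<notin> {m..<k} \<longrightarrow> a n = 0) \<and> N a \<le> 1 \<and> \<epsilon> < norm ((T \<circ> S) a)" for m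
    proof (rule ccontr)
      assume none: "\<not> ?thesis"
      have "weak_lp_norm p sY (\<lambda>n. T (x (n + m))) \<le> ennreal \<epsilon>"
      proof (rule weak_lp_norm_le)
        fix a F assume F: "finite F" "F \<subseteq> {m..}" and a: "\<And>n. n \<notin> F \<Longrightarrow> a n = 0" "N a \<le> 1"
        obtain k where "F \<subseteq> {..<k}" using F finite_nat_bounded by blast
        then have "n \<notin> {m..<k} \<longrightarrow> a n = 0" for n using F a by (cases "n \<in> F") auto
        then have "norm ((T \<circ> S) a) \<le> \<epsilon>" using none a(2) by (meson not_le)
        then show "norm (\<Sum>n\<in>F. sY (a n) (T (x n))) \<le> \<epsilon>" using fin[OF F(1) a(1)] by simp
      qed (use \<epsilon> in simp)
      then show False using neg by blast
    qed
    then obtain a k where ak: "\<And>m n. n \<notin> {m..<k m} \<Longrightarrow> a m n = 0" "\<And>m. N (a m) \<le> 1"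
      "\<And>m. \<epsilon> < norm ((T \<circ> S) (a m))"
      by metis
    have mem: "a m \<in> L" for m
      by (rule finite_support_mem[of "{m..<k m}"]) (use ak in auto)
    \<comment> \<open>Starting each block beyond the end of the preceding one makes the supports disjoint.\<close>
    define s where "s = rec_nat 0 (\<lambda>_ m. max m (k m))"
    have s: "s i \<le> s (Suc i)" "k (s i) \<le> s (Suc i)" for i by (auto simp: s_def)
    have "k (s i) \<le> s j" if "i < j" for i j
      using lift_Suc_mono_le[of s "Suc i" j] s that by (meson Suc_leI order_trans)
    then have "a (s i) n = 0 \<or> a (s j) n = 0" if "i < j" for i j n
      using ak(1)[of n "s i"] ak(1)[of n "s j"] that by (metis atLeastLessThan_iff leD order_trans not_less)
    then have disj: "a (s i) n = 0 \<or> a (s j) n = 0" if "i \<noteq> j" for i j n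
      using that by (metis linorder_neqE_nat)
    show False
      by (rule compact_disjoint_blocks_contradiction[OF Y TS, of "\<lambda>i. a (s i)" \<epsilon>])
        (use mem ak disj \<epsilon> in auto)
  qed
  then show "(\<lambda>n. T (x n)) \<in> uncond_p_summable p sY"
    using weak by (simp add: uncond_p_summable_iff)
qed

end

section \<open>Null sequences\<close>

text \<open>
  For disjoint supports, a fixed index meets at most one member of the family. The choice of \<open>i\<close> is
  arbitrary if it meets none.
\<close>

lemma disjoint_supports_single:
  fixes b :: "nat \<Rightarrow> nat \<Rightarrow> 'k::zero"
  assumes "\<And>i j. i \<noteq> j \<Longrightarrow> b i n = 0 \<or> b j n = 0"
  obtains i where "\<And>j. b j n = (if j = i then b i n else 0)"
  using assms by metis

lemma c0_space_norm_ge: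
  assumes "a \<in> c0_space" shows "norm (a n) \<le> c0_space_norm a"
proof -
  have "Bseq a"
    using assms by (auto simp: c0_space_def intro: convergent_imp_Bseq convergentI)
  then obtain K where "\<And>n. norm (a n) \<le> K" by (auto simp: Bseq_def)
  then have "bdd_above (range (\<lambda>n. norm (a n)))" by (rule bdd_aboveI2)
  then show ?thesis unfolding c0_space_norm_def by (rule cSUP_upper[OF UNIV_I])
qed

lemma c0_space_norm_le: "(\<And>n. norm (a n) \<le> C) \<Longrightarrow> c0_space_norm a \<le> C"
  unfolding c0_space_norm_def by (rule cSUP_least) auto

lemma partial_lp_norm_1: "partial_lp_norm 1 F b = (\<Sum>n\<in>F. norm (b n))"
  by (simp add: partial_lp_norm_def sum_nonneg)

lemma c0_duality: "sequence_duality 1 (c0_space :: (nat \<Rightarrow> 'k::real_or_complex) set) c0_space_norm"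
proof
  fix a b :: "nat \<Rightarrow> 'k" and c :: 'k and F
  show "(0::real) < 1" by simp
  show "(\<lambda>n. a n + b n) \<in> c0_space" if "a \<in> c0_space" "b \<in> c0_space"
    using tendsto_add[of a 0 sequentially b 0] that by (simp add: c0_space_def)
  show "(\<lambda>n. c * a n) \<in> c0_space" if "a \<in> c0_space"
    using tendsto_mult_left[of a 0 sequentially c] that by (simp add: c0_space_def)
  show "a \<in> c0_space" if F: "finite F" and a: "\<And>n. n \<notin> F \<Longrightarrow> a n = 0"
  proof -
    obtain k where "F \<subseteq> {..<k}" using F finite_nat_bounded by blast
    then have "\<forall>\<^sub>F n in sequentially. a n = 0"
      unfolding eventually_sequentially using a by (meson lessThan_iff not_le subsetD)
    then show ?thesis by (simp add: c0_space_def tendsto_eventually)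
  qed
  show "norm (\<Sum>n\<in>F. a n * b n) \<le> c0_space_norm a * partial_lp_norm 1 F b"
    if "a \<in> c0_space" "finite F"
    unfolding partial_lp_norm_1 sum_distrib_left
    by (rule sum_norm_le) (simp add: norm_mult mult_right_mono c0_space_norm_ge[OF that(1)])
  show "\<exists>a. (\<forall>n. n \<notin> F \<longrightarrow> a n = 0) \<and> c0_space_norm a \<le> 1 \<and>
      (\<Sum>n\<in>F. a n * b n) = of_real (partial_lp_norm 1 F b)" if "finite F"
  proof (intro exI[of _ "\<lambda>n. if n \<in> F then of_real (norm (b n)) / b n else 0"] conjI)
    show "c0_space_norm (\<lambda>n. if n \<in> F then of_real (norm (b n)) / b n else 0) \<le> 1"
      by (rule c0_space_norm_le) (simp add: norm_divide)
    show "(\<Sum>n\<in>F. (if n \<in> F then of_real (norm (b n)) / b n else 0) * b n) =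
        of_real (partial_lp_norm 1 F b)"
      unfolding partial_lp_norm_1 of_real_sum by (rule sum.cong) auto
  qed simp
  show "(\<lambda>m. c0_space_norm (\<lambda>n. if n < m then 0 else a n)) \<longlonglongrightarrow> 0" if a: "a \<in> c0_space"
  proof (rule LIMSEQ_I)
    fix e :: real assume e: "0 < e"
    obtain M where M: "\<And>n. M \<le> n \<Longrightarrow> norm (a n) < e / 2"
      using LIMSEQ_D[of a 0 "e / 2"] a e by (auto simp: c0_space_def)
    have "norm (c0_space_norm (\<lambda>n. if n < m then 0 else a n) - 0) < e" if "M \<le> m" for m
    proof -
      let ?t = "\<lambda>n. if n < m then 0 else a n"
      have "\<forall>\<^sub>F n in sequentially. a n = ?t n"
        by (auto simp: eventually_sequentially intro!: exI[of _ m])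
      then have "?t \<in> c0_space"
        using a tendsto_cong[of a ?t sequentially 0] by (simp add: c0_space_def)
      then have "0 \<le> c0_space_norm ?t"
        using c0_space_norm_ge[of ?t 0] norm_ge_zero order_trans by blast
      moreover have "c0_space_norm ?t \<le> e / 2"
        using M that e by (intro c0_space_norm_le) (auto simp: less_imp_le)
      ultimately show ?thesis using e by simp
    qed
    then show "\<exists>M. \<forall>m\<ge>M. norm (c0_space_norm (\<lambda>n. if n < m then 0 else a n) - 0) < e" by blast
  qed
  show "\<exists>k>0. \<forall>b. (\<forall>i. b i \<in> c0_space \<and> c0_space_norm (b i) \<le> 1) \<and>
      (\<forall>i j n. i \<noteq> j \<longrightarrow> b i n = 0 \<or> b j n = 0) \<longrightarrow>
      c0_space_norm (\<lambda>n. \<Sum>i<k. b i n :: 'k) \<le> \<delta> * real k" if \<delta>: "0 < \<delta>" for \<delta>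
  proof -
    obtain k where k: "1 / \<delta> < real k" using reals_Archimedean2 by blast
    have "0 < real k" using k \<delta> by (meson divide_pos_pos less_trans zero_less_one)
    moreover have "c0_space_norm (\<lambda>n. \<Sum>i<k. b i n) \<le> \<delta> * real k"
      if b: "\<And>i. b i \<in> c0_space" "\<And>i. c0_space_norm (b i) \<le> 1"
        and disj: "\<And>i j n. i \<noteq> j \<Longrightarrow> b i n = 0 \<or> b j n = 0" for b :: "nat \<Rightarrow> nat \<Rightarrow> 'k"
    proof (rule c0_space_norm_le)
      fix n
      obtain i where i: "\<And>j. b j n = (if j = i then b i n else 0)"
        using disjoint_supports_single[of b n] disj by blast
      have "(\<Sum>j<k. b j n) = (if i < k then b i n else 0)"
        by (subst i) simp
      then have "norm (\<Sum>j<k. b j n) \<le> norm (b i n)" by simp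
      also have "\<dots> \<le> 1" using c0_space_norm_ge[OF b(1)] b(2) by (rule order_trans)
      also have "\<dots> \<le> \<delta> * real k" using k \<delta> by (simp add: field_simps)
      finally show "norm (\<Sum>j<k. b j n) \<le> \<delta> * real k" .
    qed
    ultimately show ?thesis by (intro exI[of _ k]) auto
  qed
qed

section \<open>Conjugate exponents\<close>

lemma partial_lp_norm_nonneg: "0 \<le> partial_lp_norm p F a"
  by (simp add: partial_lp_norm_def)

lemma sum_norm_powr_normalized:
  assumes p: "0 < p" and B: "partial_lp_norm p F b \<noteq> 0"
  shows "(\<Sum>n\<in>F. (norm (b n) / partial_lp_norm p F b) powr p) = 1"
proof -
  have "(\<Sum>n\<in>F. norm (b n) powr p) = partial_lp_norm p F b powr p"
    using p by (simp add: partial_lp_norm_def powr_powr sum_nonneg)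
  then show ?thesis
    using B by (simp add: powr_divide partial_lp_norm_nonneg flip: sum_divide_distrib)
qed

lemma partial_lp_norm_eq_0D:
  assumes "finite F" "partial_lp_norm p F b = 0" "n \<in> F" shows "b n = 0"
  using assms by (auto simp: partial_lp_norm_def sum_nonneg_eq_0_iff)

text \<open>
  Young's inequality, summed over the entries of the two normalized vectors.
\<close>

lemma hoelder_sum:
  fixes a b :: "nat \<Rightarrow> 'k::real_normed_field"
  assumes pq: "1 < p" "1 < q" "1 / p + 1 / q = 1" and F: "finite F"
  shows "norm (\<Sum>n\<in>F. a n * b n) \<le> partial_lp_norm q F a * partial_lp_norm p F b"
proof (cases "partial_lp_norm q F a = 0 \<or> partial_lp_norm p F b = 0")
  case True
  then have "a n * b n = 0" if "n \<in> F" for n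
    using partial_lp_norm_eq_0D[OF F] that by (metis mult_eq_0_iff)
  then have "(\<Sum>n\<in>F. a n * b n) = 0" by (rule sum.neutral[OF ballI])
  then show ?thesis by (simp add: partial_lp_norm_nonneg)
next
  case False
  let ?A = "partial_lp_norm q F a" and ?B = "partial_lp_norm p F b"
  have AB: "0 < ?A" "0 < ?B"
    using False partial_lp_norm_nonneg[of q F a] partial_lp_norm_nonneg[of p F b] by auto
  have "(\<Sum>n\<in>F. (norm (b n) / ?B) * (norm (a n) / ?A)) \<le>
      (\<Sum>n\<in>F. (norm (b n) / ?B) powr p / p + (norm (a n) / ?A) powr q / q)"
    using AB by (intro sum_mono Youngs_inequality pq) auto
  also have "\<dots> = 1"
    using sum_norm_powr_normalized[of p F b] sum_norm_powr_normalized[of q F a] pq False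
    by (simp add: sum.distrib flip: sum_divide_distrib)
  finally have "(\<Sum>n\<in>F. norm (a n) * norm (b n)) / (?A * ?B) \<le> 1"
    by (simp add: sum_divide_distrib mult_ac)
  then have "(\<Sum>n\<in>F. norm (a n) * norm (b n)) \<le> ?A * ?B"
    using AB by (simp add: field_simps)
  then show ?thesis
    using sum_norm_le[of F "\<lambda>n. a n * b n" "\<lambda>n. norm (a n) * norm (b n)"] by (simp add: norm_mult)
qed

lemma mem_lp_space_iff: "a \<in> lp_space q \<longleftrightarrow> summable (\<lambda>n. norm (a n) powr q)"
  by (simp add: lp_space_def lp_norm_def)

lemma partial_lp_norm_le_lp_space_norm:
  assumes "0 < q" "a \<in> lp_space q" "finite F"
  shows "partial_lp_norm q F a \<le> lp_space_norm q a"
proof -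
  have "lp_norm q a \<le> ennreal (lp_space_norm q a)"
    using assms(2) by (simp add: lp_space_norm_def lp_space_def)
  then show ?thesis
    using lp_norm_le_iff[OF assms(1), of "lp_space_norm q a" a] assms(3)
    by (simp add: lp_space_norm_def)
qed

lemma lp_space_norm_le:
  assumes "0 < q" "0 \<le> C" "\<And>F. finite F \<Longrightarrow> (\<Sum>n\<in>F. norm (a n) powr q) \<le> C powr q"
  shows "lp_space_norm q a \<le> C"
proof -
  have "lp_norm q a \<le> ennreal C"
    using assms by (simp add: lp_norm_le_iff partial_lp_norm_le_iff)
  then show ?thesis
    unfolding lp_space_norm_def by (rule enn2real_leI[OF assms(2)])
qed

lemma lp_duality:
  assumes p: "1 < p"
  defines "q \<equiv> conj_exponent p"
  shows "sequence_duality p (lp_space q :: (nat \<Rightarrow> 'k::real_or_complex) set) (lp_space_norm q)"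
proof
  have q: "1 < q" and pq: "1 / p + 1 / q = 1" and pq': "(p - 1) * q = p"
    using p by (auto simp: q_def conj_exponent_def field_simps)
  have q0: "0 < q" and p0: "0 < p" using p q by auto
  fix a b :: "nat \<Rightarrow> 'k" and c :: 'k and F
  show "0 < p" by fact
  show "(\<lambda>n. a n + b n) \<in> lp_space q" if "a \<in> lp_space q" "b \<in> lp_space q"
    unfolding mem_lp_space_iff
  proof (rule summable_comparison_test')
    show "summable (\<lambda>n. 2 powr q * (norm (a n) powr q + norm (b n) powr q))"
      using that by (intro summable_mult summable_add) (auto simp: mem_lp_space_iff)
    fix n
    let ?m = "max (norm (a n)) (norm (b n))"
    have "norm (a n + b n) powr q \<le> (2 * ?m) powr q"
      using norm_triangle_ineq[of "a n" "b n"] q0 by (intro powr_mono2) auto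
    also have "\<dots> = 2 powr q * ?m powr q" by (simp add: powr_mult)
    also have "\<dots> \<le> 2 powr q * (norm (a n) powr q + norm (b n) powr q)"
      by (intro mult_left_mono) (auto simp: max_def)
    finally show "norm (norm (a n + b n) powr q) \<le> 2 powr q * (norm (a n) powr q + norm (b n) powr q)"
      by simp
  qed
  show "(\<lambda>n. c * a n) \<in> lp_space q" if "a \<in> lp_space q"
    using summable_mult[of "\<lambda>n. norm (a n) powr q" "norm c powr q"] that
    by (simp add: mem_lp_space_iff norm_mult powr_mult)
  show "a \<in> lp_space q" if "finite F" "\<And>n. n \<notin> F \<Longrightarrow> a n = 0"
    unfolding mem_lp_space_iff using that by (intro summable_finite[of F]) auto
  show "norm (\<Sum>n\<in>F. a n * b n) \<le> lp_space_norm q a * partial_lp_norm p F b"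
    if "a \<in> lp_space q" "finite F"
    using hoelder_sum[OF p q pq that(2), of a b]
      mult_right_mono[OF partial_lp_norm_le_lp_space_norm[OF q0 that], of "partial_lp_norm p F b"]
      partial_lp_norm_nonneg[of p F b] by linarith
  show "\<exists>a. (\<forall>n. n \<notin> F \<longrightarrow> a n = 0) \<and> lp_space_norm q a \<le> 1 \<and>
      (\<Sum>n\<in>F. a n * b n) = of_real (partial_lp_norm p F b)" if F: "finite F"
  proof (cases "partial_lp_norm p F b = 0")
    case True
    then show ?thesis
      using q0 by (intro exI[of _ "\<lambda>_. 0"]) (auto intro!: lp_space_norm_le)
  next
    case False
    define B where "B = partial_lp_norm p F b"
    have B: "0 < B" using False partial_lp_norm_nonneg[of p F b] by (simp add: B_def)
    have one: "(\<Sum>n\<in>F. (norm (b n) / B) powr p) = 1"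
      using sum_norm_powr_normalized[OF p0 False] by (simp add: B_def)
    \<comment> \<open>The moduli of the entries are \<open>(norm (b n) / B) powr (p - 1)\<close>, the equality case of Hoelder's
      inequality; the phases are opposite to those of \<open>b\<close>.\<close>
    define d where "d n = (if n \<in> F then of_real ((norm (b n) / B) powr p * B) / b n else 0)" for n
    have "norm (d n) = (norm (b n) / B) powr (p - 1)" if "n \<in> F" "b n \<noteq> 0" for n
      using that B by (simp add: d_def norm_divide norm_mult powr_diff field_simps)
    then have nd: "norm (d n) powr q = (if n \<in> F then (norm (b n) / B) powr p else 0)" for n
      by (cases "b n = 0") (auto simp: powr_powr pq' d_def)
    have "lp_space_norm q d \<le> 1"
    proof (rule lp_space_norm_le[OF q0])
      fix G :: "nat set" assume G: "finite G"
      have "(\<Sum>n\<in>G. norm (d n) powr q) \<le> (\<Sum>n\<in>G \<union> F. norm (d n) powr q)"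
        using F G by (intro sum_mono2) auto
      also have "\<dots> = (\<Sum>n\<in>F. norm (d n) powr q)"
        using F G by (intro sum.mono_neutral_right) (auto simp: nd)
      also have "\<dots> = 1" using one by (simp add: nd)
      finally show "(\<Sum>n\<in>G. norm (d n) powr q) \<le> 1 powr q" by simp
    qed simp
    moreover have "(\<Sum>n\<in>F. d n * b n) = of_real B"
    proof -
      have "(\<Sum>n\<in>F. d n * b n) = (\<Sum>n\<in>F. of_real ((norm (b n) / B) powr p * B))"
        by (rule sum.cong) (auto simp: d_def)
      also have "\<dots> = of_real ((\<Sum>n\<in>F. (norm (b n) / B) powr p) * B)"
        by (simp only: of_real_sum sum_distrib_right)
      finally show ?thesis by (simp add: one)
    qed
    ultimately show ?thesis by (intro exI[of _ d]) (auto simp: d_def B_def)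
  qed
  show "(\<lambda>m. lp_space_norm q (\<lambda>n. if n < m then 0 else a n)) \<longlonglongrightarrow> 0" if a: "a \<in> lp_space q"
  proof -
    have s: "summable (\<lambda>n. norm (a n) powr q)" using a by (simp add: mem_lp_space_iff)
    have "lp_space_norm q (\<lambda>n. if n < m then 0 else a n) =
        (\<Sum>n. norm (a (n + m)) powr q) powr (1 / q)" for m
    proof -
      let ?t = "\<lambda>n. norm (if n < m then 0 else a n) powr q"
      have t: "summable ?t"
        by (rule summable_comparison_test'[OF s, of 0]) auto
      have "suminf ?t = (\<Sum>n. ?t (n + m)) + (\<Sum>n<m. ?t n)"
        by (rule suminf_split_initial_segment[OF t])
      then have "suminf ?t = (\<Sum>n. norm (a (n + m)) powr q)" by simp
      then show ?thesis using t by (simp add: lp_space_norm_def lp_norm_def)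
    qed
    moreover have "(\<lambda>m. (\<Sum>n. norm (a (n + m)) powr q) powr (1 / q)) \<longlonglongrightarrow> 0"
      using q0 s
      by (intro tendsto_zero_powrI[where b="1 / q"] suminf_exist_split2)
        (auto intro!: always_eventually suminf_nonneg summable_ignore_initial_segment[of _ m for m])
    ultimately show ?thesis by simp
  qed
  \<comment> \<open>The sum of \<open>k\<close> disjoint blocks of norm at most \<open>1\<close> has norm at most \<open>k powr (1 / q)\<close>, and
    \<open>1 / q < 1\<close>.\<close>
  show "\<exists>k>0. \<forall>b. (\<forall>i. b i \<in> lp_space q \<and> lp_space_norm q (b i) \<le> 1) \<and>
      (\<forall>i j n. i \<noteq> j \<longrightarrow> b i n = 0 \<or> b j n = 0) \<longrightarrow>
      lp_space_norm q (\<lambda>n. \<Sum>i<k. b i n :: 'k) \<le> \<delta> * real k" if \<delta>: "0 < \<delta>" for \<delta>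
  proof -
    have "(\<lambda>k. real k powr (- (1 / p))) \<longlonglongrightarrow> 0"
      using p0 by (intro tendsto_neg_powr filterlim_real_sequentially) auto
    then have "\<forall>\<^sub>F k in sequentially. real k powr (- (1 / p)) < \<delta>"
      using \<delta> by (rule order_tendstoD(2))
    then have "\<forall>\<^sub>F k in sequentially. real k powr (- (1 / p)) < \<delta> \<and> 0 < k"
      by (intro eventually_conj eventually_gt_at_top)
    then obtain k where k: "real k powr (- (1 / p)) < \<delta>" "0 < k"
      by (auto simp: eventually_sequentially)
    have "real k powr (1 / q) = real k powr (1 + - (1 / p))"
      using pq by (intro arg_cong2[of _ _ _ _ "(powr)"]) auto
    also have "\<dots> = real k * real k powr (- (1 / p))"
      using k(2) by (subst powr_add) simp
    also have "\<dots> \<le> \<delta> * real k" using k by (simp add: mult.commute)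
    finally have k_le: "real k powr (1 / q) \<le> \<delta> * real k" .
    have "lp_space_norm q (\<lambda>n. \<Sum>i<k. b i n) \<le> real k powr (1 / q)"
      if b: "\<And>i. b i \<in> lp_space q" "\<And>i. lp_space_norm q (b i) \<le> 1"
        and disj: "\<And>i j n. i \<noteq> j \<Longrightarrow> b i n = 0 \<or> b j n = 0" for b :: "nat \<Rightarrow> nat \<Rightarrow> 'k"
    proof (rule lp_space_norm_le[OF q0])
      fix F :: "nat set" assume F: "finite F"
      have "norm (\<Sum>j<k. b j n) powr q = (\<Sum>j<k. norm (b j n) powr q)" for n
      proof -
        obtain i where i: "\<And>j. b j n = (if j = i then b i n else 0)"
          using disjoint_supports_single[of b n] disj by blast
        have "(\<Sum>j<k. b j n) = (if i < k then b i n else 0)"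
          by (subst i) simp
        moreover have "(\<Sum>j<k. norm (b j n) powr q) = (\<Sum>j<k. if j = i then norm (b i n) powr q else 0)"
          by (rule sum.cong[OF refl], subst i) simp
        ultimately show ?thesis by simp
      qed
      then have "(\<Sum>n\<in>F. norm (\<Sum>j<k. b j n) powr q) = (\<Sum>j<k. \<Sum>n\<in>F. norm (b j n) powr q)"
        by (simp add: sum.swap[of _ F])
      also have "\<dots> \<le> (\<Sum>j<k. 1)"
      proof (rule sum_mono)
        fix j
        have "partial_lp_norm q F (b j) \<le> 1"
          using partial_lp_norm_le_lp_space_norm[OF q0 b(1) F] b(2) by (rule order_trans)
        then show "(\<Sum>n\<in>F. norm (b j n) powr q) \<le> 1"
          using q0 by (simp add: partial_lp_norm_le_iff)
      qed
      also have "\<dots> = (real k powr (1 / q)) powr q" using q0 by (simp add: powr_powr)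
      finally show "(\<Sum>n\<in>F. norm (\<Sum>j<k. b j n) powr q) \<le> (real k powr (1 / q)) powr q" .
    qed simp
    then show ?thesis
      using k(2) by (intro exI[of _ k]) (auto intro!: order_trans[OF _ k_le])
  qed
qed

section \<open>Unconditionally p-converging operators\<close>

theorem theorem2p1:
  fixes p :: real
    and sX :: "'k::real_or_complex \<Rightarrow> 'a::banach \<Rightarrow> 'a"
    and sY :: "'k \<Rightarrow> 'b::banach \<Rightarrow> 'b"
    and T :: "'a \<Rightarrow> 'b"
  assumes "1 \<le> p"
    and "banach_space sX" and "banach_space sY"
    and "is_operator sX sY T"
  shows "uncond_p_converging p sX sY T \<longleftrightarrow>
    (if p = 1
     then \<forall>S. is_seq_operator c0_space c0_space_norm sX S \<longrightarrow>
            is_compact_seq_operator c0_space c0_space_norm sY (T \<circ> S)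
     else \<forall>S. is_seq_operator (lp_space (conj_exponent p)) (lp_space_norm (conj_exponent p)) sX S \<longrightarrow>
            is_compact_seq_operator (lp_space (conj_exponent p)) (lp_space_norm (conj_exponent p)) sY (T \<circ> S))"
proof -
  have equiv: "uncond_p_converging p sX sY T \<longleftrightarrow>
      (\<forall>S. is_seq_operator L N sX S \<longrightarrow> is_compact_seq_operator L N sY (T \<circ> S))"
    if "sequence_duality p L N" for L :: "(nat \<Rightarrow> 'k) set" and N
    using sequence_duality.compact_of_uncond_p_converging[OF that assms(2-4)]
      sequence_duality.uncond_p_converging_of_compact[OF that assms(2-4)] by blast
  show ?thesis
  proof (cases "p = 1")
    case True
    then show ?thesis using equiv[of c0_space c0_space_norm] c0_duality by simp
  next
    case False
    then show ?thesis using equiv[OF lp_duality] assms(1) by simp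
  qed
qed

end
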